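(* Let $K$ be a finite CW complex with CW structure $\mathcal K$, let $\mathcal V$ be an acyclic discrete vector field on $\mathcal K$, let $\alpha_0\in\operatorname{dom}\mathcal V$, $\alpha_1:=\mathcal V(\alpha_0)$ and $\alpha:=(\alpha_0,\alpha_1)$. Let $K/R_\alpha$ be the $\alpha$-collapse of $K$, with quotient map $\kappa_\alpha$ and cells $\kappa_\alpha(\sigma)$, $\sigma\in\mathcal K\setminus\{\alpha_0,\alpha_1\}$. Define a partial self-map $\mathcal V_\alpha$ of the set of cells of $K/R_\alpha$ by $$\operatorname{dom}\mathcal V_\alpha:=\{\kappa_\alpha(\sigma)\mid\sigma\in\operatorname{dom}\mathcal V\setminus\{\alpha_0\}\},\qquad \mathcal V_\alpha(\kappa_\alpha(\sigma)):=\kappa_\alpha(\mathcal V(\sigma)).$$ Then $\mathcal V_\alpha$ is a well defined discrete vector field on $K/R_\alpha$ and it is also acyclic.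
   Context: A finite CW complex is a Hausdorff space $K$ with a finite partition $\mathcal K$ of $K$ into cells and, for each cell $\sigma$ of dimension $|\sigma|$, a characteristic map $\varphi_\sigma:B^{|\sigma|}\to K$ (continuous, mapping the open ball homeomorphically onto $\sigma$, and mapping $S^{|\sigma|-1}$ into the union of cells of dimension at most $|\sigma|-1$). Characteristic maps may be freely replaced by their compositions with homeomorphisms onto $B^{|\sigma|}$ (in particular $B^{|\sigma|}$ may be replaced by any homeomorphic set). A subcomplex is a union of cells that is closed in $K$. A cell $\tau$ is a facet of $\sigma$ if $\tau\cap\operatorname{cl}\sigma\ne\emptyset$ and $|\tau|=|\sigma|-1$. Let $H^n_-=\{x\in S^{n-1}\mid x_n\le0\}$, $H^n_+=\{x\in S^{n-1}\mid x_n\ge0\}$ be the closed hemispheres of $S^{n-1}\subset\mathbb R^n$. A facet $\alpha_0$ of an $n$-cell $\alpha_1$ is regular if the characteristic map $\varphi_{\alpha_1}$ satisfies: (i) $\varphi_{\alpha_1}(S^{n-1})$ is a subcomplex of $K$; (ii) $\varphi_{\alpha_1}|_{H^n_-}$ is the characteristic map of $\alpha_0$ (with $H^n_-$ in place of $B^{n-1}$); (iii) $\varphi_{\alpha_1}(H^n_+)\cap\alpha_0=\emptyset$. Then $\alpha=(\alpha_0,\alpha_1)$ is called a reduction pair. A discrete vector field on $\mathcal K$ is a partition of $\mathcal K$ into singletons and doubletons such that each doubleton, ordered by dimension, is a reduction pair. It is identified with an injective partial self-map $\mathcal V$ of $\mathcal K$ such that $\mathcal K$ is the disjoint union of $\operatorname{dom}\mathcal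 V$, $\operatorname{im}\mathcal V$ and the set $\operatorname{crit}\mathcal V$ of critical cells (singletons), and $(\sigma,\mathcal V(\sigma))$ is a reduction pair for each $\sigma\in\operatorname{dom}\mathcal V$. Let $G_{\mathcal V}$ be the directed graph on the cells with an edge from each $\sigma$ to each of its facets $\tau$, reversed if $\sigma=\mathcal V(\tau)$; $\mathcal V$ is acyclic if $G_{\mathcal V}$ has no directed cycle. For a reduction pair $\alpha$ with $n=|\alpha_1|$ put $\varphi_\alpha:=\varphi_{\alpha_1}$, $K_\alpha:=\operatorname{cl}\alpha_1$, $K_\alpha^+:=\varphi_\alpha(H^n_+)$. Fix a homeomorphism $\chi=(\chi_1,\chi_2):B^n\to B^{n-1}\times[0,1]$ with $\chi(H^n_-)=B^{n-1}\times\{1\}\cup S^{n-2}\times[0,1]$, $\chi(H^n_+)=B^{n-1}\times\{0\}$, and let $\chi_\alpha:=\varphi_\alpha\circ\chi^{-1}$. Define $f_\alpha:K_\alpha\to K_\alpha^+$ by $f_\alpha(x)=\chi_\alpha(\chi_1(\varphi_\alpha^{-1}(x)),0)$ for $x\in\alpha_0\cup\alpha_1$ and $f_\alpha(x)=x$ otherwise. Let $R_\alpha$ be the equivalence relation on $K$ with $xR_\alpha y$ iff $x=y$ or ($x,y\in K_\alpha$ and $f_\alpha(x)=f_\alpha(y)$), and let $\kappa_\alpha:K\to K/R_\alpha$ be the quotient map. The $\alpha$-collapse $K/R_\alpha$ is a CW complex with cells $\kappa_\alpha(\sigma)$ and characteristic maps $\kappa_\alpha\circ\varphi_\sigma$ for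 $\sigma\in\mathcal K\setminus\{\alpha_0,\alpha_1\}$. *)

theory Defs
  imports "HOL-Analysis.Analysis"
begin

section \<open>Balls, spheres and hemispheres\<close>

text \<open>Points of \<open>\<real>\<^sup>n\<close> are the points of \<^const>\<open>Euclidean_space\<close>: functions \<open>x :: nat \<Rightarrow> real\<close> vanishing
  from index \<open>n\<close> on. The coordinates \<open>x\<^sub>1, \<dots>, x\<^sub>n\<close> are \<open>x 0, \<dots>, x (n - 1)\<close>.
  The argument of \<open>bd_sphere\<close>, \<open>hemi_minus\<close>, \<open>hemi_plus\<close> is the dimension of the ambient space, so
  \<open>bd_sphere n\<close> is the sphere of dimension \<open>n - 1\<close> and \<open>bd_sphere 0\<close> is empty.\<close>

definition unit_ball :: "nat \<Rightarrow> (nat \<Rightarrow> real) set" where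
  "unit_ball n = {x \<in> topspace (Euclidean_space n). (\<Sum>i<n. (x i)\<^sup>2) \<le> 1}"

definition open_unit_ball :: "nat \<Rightarrow> (nat \<Rightarrow> real) set" where
  "open_unit_ball n = {x \<in> topspace (Euclidean_space n). (\<Sum>i<n. (x i)\<^sup>2) < 1}"

definition bd_sphere :: "nat \<Rightarrow> (nat \<Rightarrow> real) set" where
  "bd_sphere n = {x \<in> topspace (Euclidean_space n). (\<Sum>i<n. (x i)\<^sup>2) = 1}"

definition hemi_minus :: "nat \<Rightarrow> (nat \<Rightarrow> real) set" where
  "hemi_minus n = {x \<in> bd_sphere n. x (n - 1) \<le> 0}"

definition hemi_plus :: "nat \<Rightarrow> (nat \<Rightarrow> real) set" where
  "hemi_plus n = {x \<in> bd_sphere n. x (n - 1) \<ge> 0}"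

abbreviation top_of_Rn :: "nat \<Rightarrow> (nat \<Rightarrow> real) set \<Rightarrow> (nat \<Rightarrow> real) topology" where
  "top_of_Rn n A \<equiv> subtopology (Euclidean_space n) A"


section \<open>Finite CW complexes\<close>

text \<open>\<open>cw_dim\<close> and \<open>cw_char\<close> are only meaningful on members of \<open>cw_cells\<close>, and \<open>cw_char K \<sigma>\<close> only
  on \<open>unit_ball (cw_dim K \<sigma>)\<close>.\<close>

record 'a cw =
  cw_top :: "'a topology"
  cw_cells :: "'a set set"
  cw_dim :: "'a set \<Rightarrow> nat"
  cw_char :: "'a set \<Rightarrow> (nat \<Rightarrow> real) \<Rightarrow> 'a"

definition finite_cw_complex :: "'a cw \<Rightarrow> bool" where
  "finite_cw_complex K \<longleftrightarrow>
     Hausdorff_space (cw_top K) \<and>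
     finite (cw_cells K) \<and>
     partition_on (topspace (cw_top K)) (cw_cells K) \<and>
     (\<forall>\<sigma> \<in> cw_cells K.
        continuous_map (top_of_Rn (cw_dim K \<sigma>) (unit_ball (cw_dim K \<sigma>))) (cw_top K) (cw_char K \<sigma>) \<and>
        homeomorphic_map (top_of_Rn (cw_dim K \<sigma>) (open_unit_ball (cw_dim K \<sigma>)))
          (subtopology (cw_top K) \<sigma>) (cw_char K \<sigma>) \<and>
        cw_char K \<sigma> ` bd_sphere (cw_dim K \<sigma>) \<subseteq> \<Union>{\<tau> \<in> cw_cells K. cw_dim K \<tau> < cw_dim K \<sigma>})"

definition subcomplex :: "'a cw \<Rightarrow> 'a set \<Rightarrow> bool" where
  "subcomplex K L \<longleftrightarrow> (\<exists>C \<subseteq> cw_cells K. L = \<Union>C) \<and> closedin (cw_top K) L"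

definition facet :: "'a cw \<Rightarrow> 'a set \<Rightarrow> 'a set \<Rightarrow> bool" where
  "facet K \<tau> \<sigma> \<longleftrightarrow> \<tau> \<in> cw_cells K \<and> \<sigma> \<in> cw_cells K \<and>
     \<tau> \<inter> (cw_top K closure_of \<sigma>) \<noteq> {} \<and> cw_dim K \<sigma> = cw_dim K \<tau> + 1"

text \<open>Characteristic maps may be replaced by their compositions with homeomorphisms onto the ball:
  \<open>char_map_on K \<sigma> D \<phi>\<close> says that \<open>\<phi>\<close> is the characteristic map of \<open>\<sigma>\<close>, reparametrised to have the
  space \<open>D\<close> as its domain in place of the ball.\<close>

definition char_map_on ::
    "'a cw \<Rightarrow> 'a set \<Rightarrow> (nat \<Rightarrow> real) topology \<Rightarrow> ((nat \<Rightarrow> real) \<Rightarrow> 'a) \<Rightarrow> bool" where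
  "char_map_on K \<sigma> D \<phi> \<longleftrightarrow>
     (\<exists>h. homeomorphic_map D (top_of_Rn (cw_dim K \<sigma>) (unit_ball (cw_dim K \<sigma>))) h \<and>
          (\<forall>x \<in> topspace D. \<phi> x = cw_char K \<sigma> (h x)))"


section \<open>Reduction pairs\<close>

text \<open>\<open>reduction_chart K \<alpha>\<^sub>0 \<alpha>\<^sub>1 \<phi>\<close>: the (possibly reparametrised) characteristic map \<open>\<phi>\<close> of \<open>\<alpha>\<^sub>1\<close>
  witnesses that \<open>\<alpha>\<^sub>0\<close> is a regular facet of \<open>\<alpha>\<^sub>1\<close>. This \<open>\<phi>\<close> is the map \<open>\<phi>\<^sub>\<alpha>\<close> of the pair.\<close>

definition reduction_chart :: "'a cw \<Rightarrow> 'a set \<Rightarrow> 'a set \<Rightarrow> ((nat \<Rightarrow> real) \<Rightarrow> 'a) \<Rightarrow> bool" where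
  "reduction_chart K \<alpha>\<^sub>0 \<alpha>\<^sub>1 \<phi> \<longleftrightarrow>
     facet K \<alpha>\<^sub>0 \<alpha>\<^sub>1 \<and>
     (let n = cw_dim K \<alpha>\<^sub>1 in
        char_map_on K \<alpha>\<^sub>1 (top_of_Rn n (unit_ball n)) \<phi> \<and>
        subcomplex K (\<phi> ` bd_sphere n) \<and>
        char_map_on K \<alpha>\<^sub>0 (top_of_Rn n (hemi_minus n)) \<phi> \<and>
        \<phi> ` hemi_plus n \<inter> \<alpha>\<^sub>0 = {})"

definition reduction_pair :: "'a cw \<Rightarrow> 'a set \<Rightarrow> 'a set \<Rightarrow> bool" where
  "reduction_pair K \<alpha>\<^sub>0 \<alpha>\<^sub>1 \<longleftrightarrow> (\<exists>\<phi>. reduction_chart K \<alpha>\<^sub>0 \<alpha>\<^sub>1 \<phi>)"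


section \<open>Discrete vector fields\<close>

text \<open>The critical cells are those in \<open>cw_cells K - (dom V \<union> ran V)\<close>.\<close>

definition discrete_vector_field :: "'a cw \<Rightarrow> ('a set \<rightharpoonup> 'a set) \<Rightarrow> bool" where
  "discrete_vector_field K V \<longleftrightarrow>
     finite_cw_complex K \<and>
     dom V \<subseteq> cw_cells K \<and> ran V \<subseteq> cw_cells K \<and>
     inj_on V (dom V) \<and> dom V \<inter> ran V = {} \<and>
     (\<forall>\<sigma> \<tau>. V \<sigma> = Some \<tau> \<longrightarrow> reduction_pair K \<sigma> \<tau>)"

definition vf_graph :: "'a cw \<Rightarrow> ('a set \<rightharpoonup> 'a set) \<Rightarrow> ('a set \<times> 'a set) set" where
  "vf_graph K V =
     {(\<sigma>, \<tau>). facet K \<tau> \<sigma> \<and> V \<tau> \<noteq> Some \<sigma>} \<union> {(\<tau>, \<sigma>). facet K \<tau> \<sigma> \<and> V \<tau> = Some \<sigma>}"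

definition acyclic_vf :: "'a cw \<Rightarrow> ('a set \<rightharpoonup> 'a set) \<Rightarrow> bool" where
  "acyclic_vf K V \<longleftrightarrow> acyclic (vf_graph K V)"


section \<open>Quotient spaces\<close>

definition quotient_topology :: "'a topology \<Rightarrow> ('a \<times> 'a) set \<Rightarrow> 'a set topology" where
  "quotient_topology X R =
     topology (\<lambda>U. U \<subseteq> topspace X // R \<and> openin X {x \<in> topspace X. R `` {x} \<in> U})"

lemma openin_quotient_topology:
  "openin (quotient_topology X R) U \<longleftrightarrow>
     U \<subseteq> topspace X // R \<and> openin X {x \<in> topspace X. R `` {x} \<in> U}"
proof -
  let ?P = "\<lambda>U. U \<subseteq> topspace X // R \<and> openin X {x \<in> topspace X. R `` {x} \<in> U}"
  have "?P (S \<inter> T)" if "?P S" "?P T" for S T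
  proof -
    have "{x \<in> topspace X. R `` {x} \<in> S \<inter> T} =
        {x \<in> topspace X. R `` {x} \<in> S} \<inter> {x \<in> topspace X. R `` {x} \<in> T}"
      by auto
    then show ?thesis
      using that by (auto intro: openin_Int)
  qed
  moreover have "?P (\<Union>\<K>)" if "\<forall>S \<in> \<K>. ?P S" for \<K>
  proof -
    have "{x \<in> topspace X. R `` {x} \<in> \<Union>\<K>} = (\<Union>S \<in> \<K>. {x \<in> topspace X. R `` {x} \<in> S})"
      by auto
    moreover have "openin X (\<Union>S \<in> \<K>. {x \<in> topspace X. R `` {x} \<in> S})"
      using that by (intro openin_Union) auto
    ultimately show ?thesis
      using that by auto
  qed
  ultimately have "istopology ?P"
    unfolding istopology_def by blast
  then show ?thesis
    unfolding quotient_topology_def by (simp add: topology_inverse')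
qed

lemma quotient_map_quotient_topology:
  "quotient_map X (quotient_topology X R) (\<lambda>x. R `` {x})"
proof -
  have "{x \<in> topspace X. R `` {x} \<in> topspace X // R} = topspace X"
    by (auto simp: quotient_def)
  then have "openin (quotient_topology X R) (topspace X // R)"
    by (simp add: openin_quotient_topology)
  then have "topspace (quotient_topology X R) = topspace X // R"
    by (meson openin_quotient_topology openin_subset openin_topspace subset_antisym)
  then show ?thesis
    by (auto simp: quotient_map_def openin_quotient_topology quotient_def)
qed


section \<open>The collapse along a reduction pair\<close>

text \<open>The chosen homeomorphism from the \<open>n\<close>-ball to the cylinder, \<open>n \<ge> 1\<close>. It is called \<open>\<theta>\<close> because
  the letter chi is a binder in the library.\<close>

definition cylinder_homeo :: "nat \<Rightarrow> ((nat \<Rightarrow> real) \<Rightarrow> (nat \<Rightarrow> real) \<times> real) \<Rightarrow> bool" where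
  "cylinder_homeo n \<theta> \<longleftrightarrow>
     homeomorphic_map (top_of_Rn n (unit_ball n))
       (prod_topology (top_of_Rn (n - 1) (unit_ball (n - 1))) (top_of_set {0..1})) \<theta> \<and>
     \<theta> ` hemi_minus n = unit_ball (n - 1) \<times> {1} \<union> bd_sphere (n - 1) \<times> {0..1} \<and>
     \<theta> ` hemi_plus n = unit_ball (n - 1) \<times> {0}"

text \<open>In the following definitions \<open>\<phi>\<close> is \<open>\<phi>\<^sub>\<alpha>\<close> and \<open>\<theta>\<close> is the chosen homeomorphism. A point of
  \<open>\<alpha>\<^sub>0 \<union> \<alpha>\<^sub>1\<close> has exactly one preimage under \<open>\<phi>\<^sub>\<alpha>\<close> in the ball.\<close>

definition collapse_map ::
    "'a cw \<Rightarrow> 'a set \<Rightarrow> 'a set \<Rightarrow> ((nat \<Rightarrow> real) \<Rightarrow> 'a) \<Rightarrow> ((nat \<Rightarrow> real) \<Rightarrow> (nat \<Rightarrow> real) \<times> real) \<Rightarrow> 'a \<Rightarrow> 'a"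
  where
  "collapse_map K \<alpha>\<^sub>0 \<alpha>\<^sub>1 \<phi> \<theta> x =
     (let B = unit_ball (cw_dim K \<alpha>\<^sub>1) in
      if x \<in> \<alpha>\<^sub>0 \<union> \<alpha>\<^sub>1 then \<phi> (inv_into B \<theta> (fst (\<theta> (inv_into B \<phi> x)), 0)) else x)"

definition collapse_rel ::
    "'a cw \<Rightarrow> 'a set \<Rightarrow> 'a set \<Rightarrow> ((nat \<Rightarrow> real) \<Rightarrow> 'a) \<Rightarrow> ((nat \<Rightarrow> real) \<Rightarrow> (nat \<Rightarrow> real) \<times> real) \<Rightarrow> ('a \<times> 'a) set"
  where
  "collapse_rel K \<alpha>\<^sub>0 \<alpha>\<^sub>1 \<phi> \<theta> =
     {(x, y). x \<in> topspace (cw_top K) \<and> y \<in> topspace (cw_top K) \<and>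
        (x = y \<or>
         x \<in> cw_top K closure_of \<alpha>\<^sub>1 \<and> y \<in> cw_top K closure_of \<alpha>\<^sub>1 \<and>
         collapse_map K \<alpha>\<^sub>0 \<alpha>\<^sub>1 \<phi> \<theta> x = collapse_map K \<alpha>\<^sub>0 \<alpha>\<^sub>1 \<phi> \<theta> y)}"

definition collapse_proj ::
    "'a cw \<Rightarrow> 'a set \<Rightarrow> 'a set \<Rightarrow> ((nat \<Rightarrow> real) \<Rightarrow> 'a) \<Rightarrow> ((nat \<Rightarrow> real) \<Rightarrow> (nat \<Rightarrow> real) \<times> real) \<Rightarrow> 'a \<Rightarrow> 'a set"
  where
  "collapse_proj K \<alpha>\<^sub>0 \<alpha>\<^sub>1 \<phi> \<theta> x = collapse_rel K \<alpha>\<^sub>0 \<alpha>\<^sub>1 \<phi> \<theta> `` {x}"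

text \<open>The cell \<open>\<kappa> ` \<sigma>\<close> of the collapse inherits the dimension of \<open>\<sigma>\<close> and has characteristic map
  \<open>\<kappa> \<circ> \<phi>\<^sub>\<sigma>\<close>; \<open>\<sigma>\<close> is recovered from \<open>\<kappa> ` \<sigma>\<close> by inverting \<open>\<sigma> \<mapsto> \<kappa> ` \<sigma>\<close> on the remaining cells.\<close>

definition collapse ::
    "'a cw \<Rightarrow> 'a set \<Rightarrow> 'a set \<Rightarrow> ((nat \<Rightarrow> real) \<Rightarrow> 'a) \<Rightarrow> ((nat \<Rightarrow> real) \<Rightarrow> (nat \<Rightarrow> real) \<times> real) \<Rightarrow> 'a set cw"
  where
  "collapse K \<alpha>\<^sub>0 \<alpha>\<^sub>1 \<phi> \<theta> =
     (let \<kappa> = collapse_proj K \<alpha>\<^sub>0 \<alpha>\<^sub>1 \<phi> \<theta>;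
          rest = cw_cells K - {\<alpha>\<^sub>0, \<alpha>\<^sub>1};
          cell_of = inv_into rest (image \<kappa>)
      in \<lparr> cw_top = quotient_topology (cw_top K) (collapse_rel K \<alpha>\<^sub>0 \<alpha>\<^sub>1 \<phi> \<theta>),
           cw_cells = image \<kappa> ` rest,
           cw_dim = (\<lambda>c. cw_dim K (cell_of c)),
           cw_char = (\<lambda>c. \<kappa> \<circ> cw_char K (cell_of c)) \<rparr>)"

end

theory Submission
  imports Defs "HOL-Homology.Invariance_of_Domain"
begin

text \<open>Write \<open>n = |\<alpha>\<^sub>1|\<close> and call the cells other than \<open>\<alpha>\<^sub>0\<close> and \<open>\<alpha>\<^sub>1\<close> remaining. The collapse
  pushes every point of \<open>\<alpha>\<^sub>0 \<union> \<alpha>\<^sub>1\<close> along the cylinder lines down to a point of \<open>\<phi>(H\<^sub>+)\<close> and fixes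
  all other points, and \<open>R\<^sub>\<alpha>\<close> is the kernel of this map (\<open>collapse_rel_iff\<close>). Hence each class
  contains exactly one point of a remaining cell, and on the level of sets \<open>\<kappa>\<close> is a bijection from
  the union of the remaining cells to the quotient.

  The topology is governed by the fact that \<open>\<kappa>\<close> is a closed map (\<open>closed_map_\<kappa>\<close>), which is a
  compactness argument in the ball. It makes the quotient Hausdorff, and it makes \<open>\<kappa>\<close> commute with
  closures, so that \<open>\<kappa>(\<tau>)\<close> meets the closure of \<open>\<kappa>(\<sigma>)\<close> iff some \<open>x \<in> cl \<sigma>\<close> is identified with some
  \<open>y \<in> \<tau>\<close>. If \<open>x \<noteq> y\<close>, then \<open>x\<close> was moved: it lies in \<open>\<alpha>\<^sub>0 \<union> \<alpha>\<^sub>1\<close>, which forces \<open>|\<sigma>| \<ge> n\<close>, while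
  \<open>y \<in> \<phi>(H\<^sub>+)\<close> forces \<open>|\<tau>| < n\<close>. If moreover \<open>|\<sigma>| = |\<tau>| + 1\<close>, then \<open>|\<sigma>| = n\<close> and \<open>x \<in> \<alpha>\<^sub>0\<close>, so
  that \<open>\<alpha>\<^sub>0\<close> is a facet of \<open>\<sigma>\<close> and \<open>\<tau>\<close> is a facet of \<open>\<alpha>\<^sub>1\<close>. This is \<open>moved_closure_point\<close>, and all
  the rest rests on it:

  \<^item> new incidences lower the dimension, so \<open>\<kappa>\<close> restricts to homeomorphisms of the remaining cells
    and the boundaries of cells still lie in cells of lower dimension: the collapse is a CW complex
    (\<open>finite_cw_complex_collapse\<close>);

  \<^item> a new facet \<open>\<kappa>(\<tau>)\<close> of \<open>\<kappa>(\<sigma>)\<close> comes from the path \<open>\<sigma> \<rightarrow> \<alpha>\<^sub>0 \<rightarrow> \<alpha>\<^sub>1 \<rightarrow> \<tau>\<close> of \<open>G\<^sub>\<V>\<close>, so a directed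
    cycle of the collapse would unfold to one of \<open>K\<close> (\<open>acyclic_collapse\<close>);

  \<^item> for \<open>\<V>(\<sigma>) = \<tau>\<close>, the condition that the upper hemisphere of \<open>\<tau>\<close> misses \<open>\<sigma>\<close> could be destroyed
    only by such a new incidence, and then \<open>\<tau> \<rightarrow> \<alpha>\<^sub>0 \<rightarrow> \<alpha>\<^sub>1 \<rightarrow> \<sigma> \<rightarrow> \<tau>\<close> would be a directed cycle in
    \<open>G\<^sub>\<V>\<close> (\<open>reduction_pair_collapse\<close>). So acyclicity enters already into the proof
    that \<open>\<V>\<^sub>\<alpha>\<close> is a discrete vector field.

  Characteristic maps are given up to reparametrisation by arbitrary homeomorphisms of balls, so
  invariance of domain is used to know that these respect interiors and boundary spheres.\<close>

section \<open>Balls and hemispheres\<close>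

lemma unit_ball_split: "unit_ball n = open_unit_ball n \<union> bd_sphere n"
  by (auto simp: unit_ball_def open_unit_ball_def bd_sphere_def)

lemma open_unit_ball_disjoint_sphere: "open_unit_ball n \<inter> bd_sphere n = {}"
  by (auto simp: open_unit_ball_def bd_sphere_def)

lemma sphere_split: "bd_sphere n = hemi_minus n \<union> hemi_plus n"
  by (auto simp: hemi_minus_def hemi_plus_def)

lemma unit_ball_subset_Euclidean: "unit_ball n \<subseteq> topspace (Euclidean_space n)"
  by (auto simp: unit_ball_def)

lemma Euclidean_Int_subball [simp]:
  shows "topspace (Euclidean_space n) \<inter> unit_ball n = unit_ball n"
    and "topspace (Euclidean_space n) \<inter> open_unit_ball n = open_unit_ball n"
    and "topspace (Euclidean_space n) \<inter> hemi_minus n = hemi_minus n"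
  by (auto simp: unit_ball_def open_unit_ball_def hemi_minus_def bd_sphere_def)

lemma continuous_map_coordinate: "continuous_map (Euclidean_space n) euclideanreal (\<lambda>x. x i)"
  unfolding Euclidean_space_def
  by (intro continuous_map_from_subtopology continuous_map_product_projection) auto

lemma continuous_map_square_norm:
  "continuous_map (Euclidean_space n) euclideanreal (\<lambda>x. \<Sum>i<n. (x i)\<^sup>2)"
  by (intro continuous_intros continuous_map_coordinate) auto

lemma openin_open_unit_ball: "openin (Euclidean_space n) (open_unit_ball n)"
proof -
  have "open_unit_ball n = {x \<in> topspace (Euclidean_space n). (\<Sum>i<n. (x i)\<^sup>2) \<in> {..<1}}"
    by (auto simp: open_unit_ball_def)
  moreover have "openin (Euclidean_space n) \<dots>"
    by (rule openin_continuous_map_preimage[OF continuous_map_square_norm]) simp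
  ultimately show ?thesis by simp
qed

lemma closedin_unit_ball: "closedin (Euclidean_space n) (unit_ball n)"
proof -
  have "unit_ball n = {x \<in> topspace (Euclidean_space n). (\<Sum>i<n. (x i)\<^sup>2) \<in> {..1}}"
    by (auto simp: unit_ball_def)
  moreover have "closedin (Euclidean_space n) \<dots>"
    by (rule closedin_continuous_map_preimage[OF continuous_map_square_norm]) simp
  ultimately show ?thesis by simp
qed

text \<open>The topology of \<open>\<real>\<^sup>n\<close> is here that of a subspace of a countable product of lines, so compactness
  comes from Tychonoff's theorem for the cube \<open>[-1, 1]\<^sup>\<nat>\<close> instead of from Heine--Borel.\<close>

lemma compact_space_unit_ball: "compact_space (top_of_Rn n (unit_ball n))"
proof -
  let ?Q = "PiE UNIV (\<lambda>i::nat. {-1..1::real})"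
  have "compactin (powertop_real UNIV) ?Q"
    by (simp add: compactin_PiE)
  moreover have "closedin (powertop_real UNIV) (unit_ball n)"
    using closedin_trans_full[OF closedin_unit_ball[of n, unfolded Euclidean_space_def]]
      closedin_Euclidean_space[of n] by (simp only: topspace_Euclidean_space)
  moreover have "unit_ball n \<subseteq> ?Q"
  proof
    fix x assume x: "x \<in> unit_ball n"
    have "\<bar>x i\<bar> \<le> 1" for i
    proof (cases "i < n")
      case True
      have "(x i)\<^sup>2 \<le> (\<Sum>i<n. (x i)\<^sup>2)"
        using True by (intro member_le_sum) auto
      then have "(x i)\<^sup>2 \<le> 1"
        using x by (simp add: unit_ball_def)
      then show ?thesis
        by (simp add: abs_square_le_1)
    next
      case False
      then show ?thesis
        using x by (simp add: unit_ball_def topspace_Euclidean_space)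
    qed
    then show "x \<in> ?Q"
      by (auto simp: abs_le_iff minus_le_iff)
  qed
  ultimately have "compactin (powertop_real UNIV) (unit_ball n)"
    by (meson closed_compactin)
  then show ?thesis
    using unit_ball_subset_Euclidean[of n]
    by (simp add: Euclidean_space_def compactin_subtopology compact_space_subtopology)
qed

text \<open>Moving a point slightly along its ray stays in a given open set. Scaling up shows that no point
  of the sphere is interior to the ball, scaling down that each is a limit of interior points.\<close>

lemma openin_Euclidean_scaling:
  assumes W: "openin (Euclidean_space n) W" and x: "x \<in> W"
  obtains e where "e > 0" "\<And>t. \<bar>t - 1\<bar> < e \<Longrightarrow> (\<lambda>i. t * x i) \<in> W"
proof -
  define s where "s = (\<lambda>t::real. \<lambda>i. if i < n then t * x i else 0)"
  have s: "s t = (\<lambda>i. t * x i)" for t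
    using x openin_subset[OF W] by (auto simp: s_def topspace_Euclidean_space fun_eq_iff)
  have "continuous_map euclideanreal (Euclidean_space n) s"
    unfolding s_def continuous_map_componentwise_Euclidean_space
    by (auto intro!: continuous_intros)
  then have "open {t. s t \<in> W}"
    using openin_continuous_map_preimage[OF _ W] by fastforce
  moreover have "s 1 = x"
    by (simp add: s)
  ultimately obtain e where "e > 0" "ball 1 e \<subseteq> {t. s t \<in> W}"
    using x by (metis (mono_tags, lifting) mem_Collect_eq open_contains_ball)
  then show thesis
    by (intro that[of e]) (auto simp: s subset_iff dist_real_def abs_minus_commute)
qed

lemma sum_squares_scaled: "(\<Sum>i<n. (t * x i)\<^sup>2) = t\<^sup>2 * (\<Sum>i<n. (x i :: real)\<^sup>2)"
  by (simp add: power_mult_distrib sum_distrib_left)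

lemma openin_in_ball_imp_open_ball:
  assumes W: "openin (Euclidean_space n) W" and sub: "W \<subseteq> unit_ball n"
  shows "W \<subseteq> open_unit_ball n"
proof
  fix x assume x: "x \<in> W"
  show "x \<in> open_unit_ball n"
  proof (rule ccontr)
    assume "x \<notin> open_unit_ball n"
    then have norm1: "(\<Sum>i<n. (x i)\<^sup>2) = 1"
      using x sub by (auto simp: unit_ball_split bd_sphere_def)
    obtain e where e: "e > 0" "\<And>t. \<bar>t - 1\<bar> < e \<Longrightarrow> (\<lambda>i. t * x i) \<in> W"
      using openin_Euclidean_scaling[OF W x] by blast
    define t where "t = 1 + e / 2"
    have "t > 1" and "(\<lambda>i. t * x i) \<in> unit_ball n"
      using e sub by (auto simp: t_def)
    then have "t\<^sup>2 \<le> 1"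
      using norm1 by (simp add: unit_ball_def sum_squares_scaled)
    moreover have "t\<^sup>2 > 1"
      using \<open>t > 1\<close> by (simp add: one_less_power)
    ultimately show False by simp
  qed
qed

lemma unit_ball_subset_closure:
  "unit_ball n \<subseteq> top_of_Rn n (unit_ball n) closure_of open_unit_ball n"
proof -
  have "x \<in> Euclidean_space n closure_of open_unit_ball n" if x: "x \<in> unit_ball n" for x
    unfolding in_closure_of
  proof (intro conjI allI impI)
    show xE: "x \<in> topspace (Euclidean_space n)"
      using x by (simp add: unit_ball_def)
    fix W assume W: "x \<in> W \<and> openin (Euclidean_space n) W"
    obtain e where e: "e > 0" "\<And>t. \<bar>t - 1\<bar> < e \<Longrightarrow> (\<lambda>i. t * x i) \<in> W"
      using openin_Euclidean_scaling W by blast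
    \<comment> \<open>The maximum with 0 keeps \<open>t\<^sup>2 < 1\<close> also when \<open>e\<close> is large.\<close>
    define t where "t = max 0 (1 - e / 2)"
    have t: "0 \<le> t" "t < 1" "\<bar>t - 1\<bar> < e"
      using e by (auto simp: t_def)
    have "t\<^sup>2 * (\<Sum>i<n. (x i)\<^sup>2) \<le> t\<^sup>2 * 1"
      using x by (intro mult_left_mono) (auto simp: unit_ball_def)
    also have "\<dots> < 1"
      using t by (simp add: power_less_one_iff)
    finally have "(\<lambda>i. t * x i) \<in> open_unit_ball n"
      using xE by (simp add: open_unit_ball_def topspace_Euclidean_space sum_squares_scaled)
    then show "\<exists>y. y \<in> open_unit_ball n \<and> y \<in> W"
      using e(2)[OF t(3)] by blast
  qed
  then show ?thesis
    by (auto simp: closure_of_subtopology unit_ball_split Int_absorb1)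
qed

text \<open>By invariance of domain the image is open in \<open>\<real>\<^sup>n\<close>, so it cannot contain points of the sphere.\<close>

lemma injective_image_in_ball_open:
  assumes U: "openin (Euclidean_space n) U"
    and f: "continuous_map (top_of_Rn n U) (top_of_Rn n (unit_ball n)) f" and "inj_on f U"
  shows "f ` U \<subseteq> open_unit_ball n"
proof (rule openin_in_ball_imp_open_ball)
  show "openin (Euclidean_space n) (f ` U)"
    using assms by (intro invariance_of_domain_Euclidean_space) (auto simp: continuous_map_in_subtopology)
  show "f ` U \<subseteq> unit_ball n"
    using f openin_subset[OF U] by (auto simp: continuous_map_in_subtopology topspace_subtopology Pi_iff)
qed

lemma ball_homeo_preserves_interior:
  assumes h: "homeomorphic_map (top_of_Rn n (unit_ball n)) (top_of_Rn n (unit_ball n)) h"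
  shows "h ` open_unit_ball n = open_unit_ball n" and "h ` bd_sphere n = bd_sphere n"
proof -
  have into: "f ` open_unit_ball n \<subseteq> open_unit_ball n"
    if f: "homeomorphic_map (top_of_Rn n (unit_ball n)) (top_of_Rn n (unit_ball n)) f" for f
  proof (rule injective_image_in_ball_open[OF openin_open_unit_ball])
    have sub: "open_unit_ball n \<subseteq> unit_ball n"
      by (simp add: unit_ball_split)
    show "continuous_map (top_of_Rn n (open_unit_ball n)) (top_of_Rn n (unit_ball n)) f"
      using f sub by (meson continuous_map_from_subtopology_mono homeomorphic_imp_continuous_map)
    show "inj_on f (open_unit_ball n)"
      using homeomorphic_imp_injective_map[OF f] sub by (auto intro: inj_on_subset)
  qed
  obtain g where "homeomorphic_maps (top_of_Rn n (unit_ball n)) (top_of_Rn n (unit_ball n)) h g"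
    using h by (auto simp: homeomorphic_map_maps)
  then have g: "homeomorphic_map (top_of_Rn n (unit_ball n)) (top_of_Rn n (unit_ball n)) g"
    and hg: "\<And>x. x \<in> unit_ball n \<Longrightarrow> h (g x) = x"
    by (auto simp: homeomorphic_maps_map)
  show int: "h ` open_unit_ball n = open_unit_ball n"
  proof
    show "open_unit_ball n \<subseteq> h ` open_unit_ball n"
      using into[OF g] hg by (force simp: unit_ball_split)
  qed (rule into[OF h])
  have "h ` unit_ball n = unit_ball n" "inj_on h (unit_ball n)"
    using homeomorphic_imp_surjective_map[OF h] homeomorphic_imp_injective_map[OF h] by auto
  moreover have "bd_sphere n = unit_ball n - open_unit_ball n"
    using unit_ball_split open_unit_ball_disjoint_sphere by blast
  ultimately show "h ` bd_sphere n = bd_sphere n"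
    using int by (metis (no_types, lifting) inj_on_image_set_diff Diff_subset sup_ge1 unit_ball_split)
qed

text \<open>The open lower hemisphere is the graph of \<open>y \<mapsto> - sqrt (1 - |y|\<^sup>2)\<close> over the open ball of one
  dimension less, so \<open>h\<close> composed with the graph map is an injective continuous map of that ball into
  its closure, to which invariance of domain applies.\<close>

lemma hemi_homeo_open_hemisphere:
  assumes n: "n > 0"
    and h: "homeomorphic_map (top_of_Rn n (hemi_minus n)) (top_of_Rn (n - 1) (unit_ball (n - 1))) h"
  shows "h ` (hemi_minus n - hemi_plus n) \<subseteq> open_unit_ball (n - 1)"
proof -
  define m where "m = n - 1"
  have nm: "n = Suc m" using n by (simp add: m_def)
  define g where "g = (\<lambda>y i. if i < n then (if i < m then y i else - sqrt (1 - (\<Sum>j<m. (y j)\<^sup>2))) else 0)"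
  have cont: "continuous_map (top_of_Rn m (open_unit_ball m)) (Euclidean_space n) g"
    unfolding g_def continuous_map_componentwise_Euclidean_space
  proof (intro allI impI)
    fix i assume "i < n"
    have "continuous_map (Euclidean_space m) euclideanreal (\<lambda>y. sqrt (1 - (\<Sum>j<m. (y j)\<^sup>2)))"
      by (intro continuous_intros continuous_map_coordinate) auto
    then show "continuous_map (top_of_Rn m (open_unit_ball m)) euclideanreal
        (\<lambda>y. if i < m then y i else - sqrt (1 - (\<Sum>j<m. (y j)\<^sup>2)))"
      by (cases "i < m")
        (auto intro!: continuous_intros continuous_map_from_subtopology continuous_map_coordinate)
  qed
  have gim: "g y \<in> hemi_minus n - hemi_plus n" if "y \<in> open_unit_ball m" for y
  proof -
    have "(\<Sum>j<m. (y j)\<^sup>2) < 1"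
      using that by (simp add: open_unit_ball_def)
    moreover have "(\<Sum>j<n. (g y j)\<^sup>2) = (\<Sum>j<m. (y j)\<^sup>2) + (sqrt (1 - (\<Sum>j<m. (y j)\<^sup>2)))\<^sup>2"
      by (simp add: nm g_def)
    ultimately show ?thesis
      by (auto simp: hemi_minus_def hemi_plus_def bd_sphere_def topspace_Euclidean_space nm)
        (auto simp: g_def nm)
  qed
  have gsurj: "hemi_minus n - hemi_plus n \<subseteq> g ` open_unit_ball m"
  proof
    fix x assume x: "x \<in> hemi_minus n - hemi_plus n"
    then have xE: "\<And>i. i \<ge> n \<Longrightarrow> x i = 0" and neg: "x m < 0" and "(\<Sum>j<n. (x j)\<^sup>2) = 1"
      by (auto simp: hemi_minus_def hemi_plus_def bd_sphere_def topspace_Euclidean_space nm)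
    then have norm: "(\<Sum>j<m. (x j)\<^sup>2) = 1 - (x m)\<^sup>2"
      by (simp add: nm)
    define y where "y = (\<lambda>i. if i < m then x i else 0)"
    have sy: "(\<Sum>j<m. (y j)\<^sup>2) = 1 - (x m)\<^sup>2"
      using norm by (simp add: y_def)
    have "y \<in> open_unit_ball m"
      using sy neg by (auto simp: open_unit_ball_def topspace_Euclidean_space) (auto simp: y_def)
    moreover have "g y = x"
      using xE neg sy by (auto simp: g_def fun_eq_iff y_def nm less_Suc_eq)
    ultimately show "x \<in> g ` open_unit_ball m" by blast
  qed
  have "(h \<circ> g) ` open_unit_ball m \<subseteq> open_unit_ball m"
  proof (rule injective_image_in_ball_open[OF openin_open_unit_ball])
    show "continuous_map (top_of_Rn m (open_unit_ball m)) (top_of_Rn m (unit_ball m)) (h \<circ> g)"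
    proof (rule continuous_map_compose)
      show "continuous_map (top_of_Rn m (open_unit_ball m)) (top_of_Rn n (hemi_minus n)) g"
        using cont gim by (auto simp: continuous_map_in_subtopology)
      show "continuous_map (top_of_Rn n (hemi_minus n)) (top_of_Rn m (unit_ball m)) h"
        using homeomorphic_imp_continuous_map[OF h] by (simp add: m_def)
    qed
    have "inj_on g (open_unit_ball m)"
    proof (rule inj_onI, rule ext)
      fix y z i assume yz: "y \<in> open_unit_ball m" "z \<in> open_unit_ball m" and "g y = g z"
      then have "g y i = g z i"
        by simp
      then show "y i = z i"
        using yz by (cases "i < m") (auto simp: g_def nm open_unit_ball_def topspace_Euclidean_space)
    qed
    moreover have "inj_on h (hemi_minus n)"
      using homeomorphic_imp_injective_map[OF h] by simp
    then have "inj_on h (g ` open_unit_ball m)"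
      by (rule inj_on_subset) (use gim in auto)
    ultimately show "inj_on (h \<circ> g) (open_unit_ball m)"
      by (rule comp_inj_on)
  qed
  then show ?thesis
    using gsurj unfolding m_def by fastforce
qed

section \<open>Finite CW complexes\<close>

lemma char_map_on_cw_char: "char_map_on K \<sigma> (top_of_Rn (cw_dim K \<sigma>) (unit_ball (cw_dim K \<sigma>))) (cw_char K \<sigma>)"
  unfolding char_map_on_def by (intro exI[of _ id]) (auto simp: homeomorphic_map_id)

locale finite_cw =
  fixes K :: "'a cw"
  assumes cw: "finite_cw_complex K"
begin

abbreviation "X \<equiv> cw_top K"
abbreviation "cells \<equiv> cw_cells K"
abbreviation "cdim \<equiv> cw_dim K"

lemma Hausdorff: "Hausdorff_space X"
  and finite_cells: "finite cells"
  and cells_partition: "partition_on (topspace X) cells"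
  using cw by (auto simp: finite_cw_complex_def)

lemma cell_subset: "\<sigma> \<in> cells \<Longrightarrow> \<sigma> \<subseteq> topspace X"
  using cells_partition by (auto simp: partition_on_def)

lemma cell_unique: "\<lbrakk>\<sigma> \<in> cells; \<tau> \<in> cells; x \<in> \<sigma>; x \<in> \<tau>\<rbrakk> \<Longrightarrow> \<sigma> = \<tau>"
  using cells_partition by (auto dest: partition_onD2 disjointD)

lemma cell_nonempty: "\<sigma> \<in> cells \<Longrightarrow> \<sigma> \<noteq> {}"
  using cells_partition by (auto simp: partition_on_def)

lemma cell_exists: assumes "x \<in> topspace X" obtains \<sigma> where "\<sigma> \<in> cells" "x \<in> \<sigma>"
  using cells_partition assms by (auto simp: partition_on_def)

text \<open>A reparametrised characteristic map is as good as the given one, because a homeomorphism of the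
  ball preserves the open ball and the sphere.\<close>

lemma char_map_on_ballD:
  assumes \<sigma>: "\<sigma> \<in> cells" and \<psi>: "char_map_on K \<sigma> (top_of_Rn (cdim \<sigma>) (unit_ball (cdim \<sigma>))) \<psi>"
  shows "continuous_map (top_of_Rn (cdim \<sigma>) (unit_ball (cdim \<sigma>))) X \<psi>"
    and "\<psi> ` open_unit_ball (cdim \<sigma>) = \<sigma>"
    and "inj_on \<psi> (open_unit_ball (cdim \<sigma>))"
    and "\<psi> ` bd_sphere (cdim \<sigma>) \<subseteq> \<Union>{\<tau> \<in> cells. cdim \<tau> < cdim \<sigma>}"
proof -
  let ?n = "cdim \<sigma>" and ?c = "cw_char K \<sigma>"
  have c: "continuous_map (top_of_Rn ?n (unit_ball ?n)) X ?c"
    "homeomorphic_map (top_of_Rn ?n (open_unit_ball ?n)) (subtopology X \<sigma>) ?c"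
    "?c ` bd_sphere ?n \<subseteq> \<Union>{\<tau> \<in> cells. cdim \<tau> < ?n}"
    using cw \<sigma> by (auto simp: finite_cw_complex_def)
  obtain h where h: "homeomorphic_map (top_of_Rn ?n (unit_ball ?n)) (top_of_Rn ?n (unit_ball ?n)) h"
    and eq: "\<And>x. x \<in> unit_ball ?n \<Longrightarrow> \<psi> x = ?c (h x)"
    using \<psi> by (auto simp: char_map_on_def)
  note h_preserves = ball_homeo_preserves_interior[OF h]
  have eqi: "\<psi> x = ?c (h x)" if "x \<in> open_unit_ball ?n \<or> x \<in> bd_sphere ?n" for x
    using that eq by (auto simp: unit_ball_split)
  show "continuous_map (top_of_Rn ?n (unit_ball ?n)) X \<psi>"
    by (rule continuous_map_eq[OF continuous_map_compose[OF homeomorphic_imp_continuous_map[OF h] c(1)]])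
      (simp add: eq)
  have "\<psi> ` open_unit_ball ?n = ?c ` h ` open_unit_ball ?n"
    by (simp add: image_image eqi cong: image_cong)
  then show "\<psi> ` open_unit_ball ?n = \<sigma>"
    using homeomorphic_imp_surjective_map[OF c(2)] h_preserves(1) cell_subset[OF \<sigma>] by auto
  have "inj_on h (open_unit_ball ?n)"
    using homeomorphic_imp_injective_map[OF h] by (rule inj_on_subset) (auto simp: open_unit_ball_def unit_ball_def)
  moreover have "inj_on ?c (h ` open_unit_ball ?n)"
    using homeomorphic_imp_injective_map[OF c(2)] h_preserves(1) by simp
  ultimately have "inj_on (?c \<circ> h) (open_unit_ball ?n)"
    by (rule comp_inj_on)
  then show "inj_on \<psi> (open_unit_ball ?n)"
    using inj_on_cong[of "open_unit_ball ?n" \<psi> "?c \<circ> h"] eqi by simp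
  have "\<psi> ` bd_sphere ?n = ?c ` h ` bd_sphere ?n"
    by (simp add: image_image eqi cong: image_cong)
  then show "\<psi> ` bd_sphere ?n \<subseteq> \<Union>{\<tau> \<in> cells. cdim \<tau> < ?n}"
    using c(3) h_preserves(2) by simp
qed

lemma compactin_char_map_image:
  assumes \<psi>: "continuous_map (top_of_Rn n (unit_ball n)) X \<psi>"
    and C: "closedin (top_of_Rn n (unit_ball n)) C"
  shows "compactin X (\<psi> ` C)" and "closedin X (\<psi> ` C)"
proof -
  show "compactin X (\<psi> ` C)"
    using closedin_compact_space[OF compact_space_unit_ball C] \<psi> by (rule image_compactin)
  then show "closedin X (\<psi> ` C)"
    by (rule compactin_imp_closedin[OF Hausdorff])
qed

lemma char_map_on_ball_closure:
  assumes \<sigma>: "\<sigma> \<in> cells" and \<psi>: "char_map_on K \<sigma> (top_of_Rn (cdim \<sigma>) (unit_ball (cdim \<sigma>))) \<psi>"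
  shows "X closure_of \<sigma> = \<psi> ` unit_ball (cdim \<sigma>)"
proof
  note D = char_map_on_ballD[OF \<sigma> \<psi>]
  have "closedin X (\<psi> ` unit_ball (cdim \<sigma>))"
    using compactin_char_map_image(2)[OF D(1) closedin_topspace] by simp
  then show "X closure_of \<sigma> \<subseteq> \<psi> ` unit_ball (cdim \<sigma>)"
    using D(2) by (intro closure_of_minimal) (auto simp: unit_ball_split)
  show "\<psi> ` unit_ball (cdim \<sigma>) \<subseteq> X closure_of \<sigma>"
    using image_mono[OF unit_ball_subset_closure[of "cdim \<sigma>"], of \<psi>]
      continuous_map_image_closure_subset[OF D(1), of "open_unit_ball (cdim \<sigma>)"] D(2)
    by (simp only:)
qed

text \<open>The closure of a cell is the image of the ball, and only its sphere leaves the cell.\<close>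

lemma frontier_lower_dim:
  assumes \<sigma>: "\<sigma> \<in> cells" and \<tau>: "\<tau> \<in> cells" and x: "x \<in> \<tau>" "x \<in> X closure_of \<sigma>"
  shows "\<tau> = \<sigma> \<or> cdim \<tau> < cdim \<sigma>"
proof -
  note D = char_map_on_ballD[OF \<sigma> char_map_on_cw_char]
  obtain b where b: "b \<in> unit_ball (cdim \<sigma>)" "x = cw_char K \<sigma> b"
    using x(2) char_map_on_ball_closure[OF \<sigma> char_map_on_cw_char] by blast
  show ?thesis
  proof (cases "b \<in> open_unit_ball (cdim \<sigma>)")
    case True
    then show ?thesis using D(2) b x \<sigma> \<tau> cell_unique by blast
  next
    case False
    then obtain \<rho> where "\<rho> \<in> cells" "cdim \<rho> < cdim \<sigma>" "x \<in> \<rho>"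
      using D(4) b by (auto simp: unit_ball_split)
    then show ?thesis using x \<tau> cell_unique by blast
  qed
qed

lemma compact_space: "compact_space X"
proof -
  have "compactin X (X closure_of \<sigma>)" if "\<sigma> \<in> cells" for \<sigma>
    using compactin_char_map_image(1)[OF char_map_on_ballD(1)[OF that char_map_on_cw_char] closedin_topspace]
      char_map_on_ball_closure[OF that char_map_on_cw_char] by simp
  then have "compactin X (\<Union>\<sigma>\<in>cells. X closure_of \<sigma>)"
    using finite_cells by (intro compactin_Union) auto
  moreover have "(\<Union>\<sigma>\<in>cells. X closure_of \<sigma>) = topspace X"
  proof
    show "topspace X \<subseteq> (\<Union>\<sigma>\<in>cells. X closure_of \<sigma>)"
      using closure_of_subset[OF cell_subset] by (blast elim: cell_exists)
  qed (use closure_of_subset_topspace in fastforce)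
  ultimately show ?thesis
    by (simp add: compact_space_def)
qed

end

section \<open>The collapse of a reduction pair\<close>

locale cell_collapse = finite_cw K for K :: "'a cw" +
  fixes \<alpha>\<^sub>0 \<alpha>\<^sub>1 :: "'a set"
    and \<phi> :: "(nat \<Rightarrow> real) \<Rightarrow> 'a"
    and \<theta> :: "(nat \<Rightarrow> real) \<Rightarrow> (nat \<Rightarrow> real) \<times> real"
  assumes chart: "reduction_chart K \<alpha>\<^sub>0 \<alpha>\<^sub>1 \<phi>"
    and cylinder: "cylinder_homeo (cw_dim K \<alpha>\<^sub>1) \<theta>"
begin

abbreviation "n \<equiv> cdim \<alpha>\<^sub>1"
abbreviation "rest \<equiv> cells - {\<alpha>\<^sub>0, \<alpha>\<^sub>1}"
abbreviation "pushed \<equiv> collapse_map K \<alpha>\<^sub>0 \<alpha>\<^sub>1 \<phi> \<theta>"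
abbreviation "\<kappa> \<equiv> collapse_proj K \<alpha>\<^sub>0 \<alpha>\<^sub>1 \<phi> \<theta>"
abbreviation "K' \<equiv> collapse K \<alpha>\<^sub>0 \<alpha>\<^sub>1 \<phi> \<theta>"
abbreviation "Xq \<equiv> quotient_topology X (collapse_rel K \<alpha>\<^sub>0 \<alpha>\<^sub>1 \<phi> \<theta>)"

text \<open>This is \<open>\<theta>\<inverse> \<circ> (u, t) \<mapsto> (u, 0) \<circ> \<theta>\<close>, the map of the ball onto \<open>H\<^sub>+\<close> that \<open>f\<^sub>\<alpha>\<close> becomes in the
  coordinates of the chart; see \<open>pushed_chart\<close> below.\<close>

definition push :: "(nat \<Rightarrow> real) \<Rightarrow> nat \<Rightarrow> real" where
  "push b = inv_into (unit_ball n) \<theta> (fst (\<theta> b), 0)"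

subsection \<open>The chart of the pair\<close>

lemma facet_pair: "\<alpha>\<^sub>0 \<in> cells" "\<alpha>\<^sub>1 \<in> cells" "n = cdim \<alpha>\<^sub>0 + 1" "\<alpha>\<^sub>0 \<noteq> \<alpha>\<^sub>1"
  using chart by (auto simp: reduction_chart_def facet_def)

lemma chart_ball: "char_map_on K \<alpha>\<^sub>1 (top_of_Rn n (unit_ball n)) \<phi>"
  using chart by (simp add: reduction_chart_def Let_def)

lemma hemi_plus_subset: "hemi_plus n \<subseteq> unit_ball n"
  by (auto simp: unit_ball_split sphere_split)

lemmas chart_cont = char_map_on_ballD(1)[OF facet_pair(2) chart_ball]
lemmas chart_open_ball = char_map_on_ballD(2)[OF facet_pair(2) chart_ball]
lemmas chart_inj_open_ball = char_map_on_ballD(3)[OF facet_pair(2) chart_ball]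
lemmas chart_sphere_lower = char_map_on_ballD(4)[OF facet_pair(2) chart_ball]
lemmas chart_closure = char_map_on_ball_closure[OF facet_pair(2) chart_ball]

text \<open>As \<open>\<alpha>\<^sub>0\<close> misses \<open>\<phi>(H\<^sub>+)\<close>, it is covered by the open lower hemisphere. Conversely, that hemisphere
  goes into the open ball of the chart of \<open>\<alpha>\<^sub>0\<close>, hence into \<open>\<alpha>\<^sub>0\<close>.\<close>

lemma chart_open_hemisphere:
  shows "\<phi> ` (hemi_minus n - hemi_plus n) = \<alpha>\<^sub>0" and "inj_on \<phi> (hemi_minus n - hemi_plus n)"
proof -
  let ?m = "n - 1" and ?c = "cw_char K \<alpha>\<^sub>0" and ?H = "hemi_minus n - hemi_plus n"
  have m: "cdim \<alpha>\<^sub>0 = ?m" and n: "n > 0"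
    using facet_pair(3) by auto
  obtain h where h: "homeomorphic_map (top_of_Rn n (hemi_minus n)) (top_of_Rn ?m (unit_ball ?m)) h"
    and eq: "\<And>x. x \<in> hemi_minus n \<Longrightarrow> \<phi> x = ?c (h x)"
    using chart by (auto simp: reduction_chart_def Let_def char_map_on_def m)
  note c = char_map_on_ballD[OF facet_pair(1) char_map_on_cw_char, unfolded m]
  have into: "h ` ?H \<subseteq> open_unit_ball ?m"
    by (rule hemi_homeo_open_hemisphere[OF n h])
  have "inj_on ?c (h ` ?H)"
    using c(3) into by (rule inj_on_subset)
  moreover have "inj_on h ?H"
    using homeomorphic_imp_injective_map[OF h] by (rule inj_on_subset) auto
  ultimately have "inj_on (?c \<circ> h) ?H"
    by (simp add: comp_inj_on)
  then show "inj_on \<phi> ?H"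
    using inj_on_cong[of ?H \<phi> "?c \<circ> h"] eq by simp
  have disj: "\<phi> ` hemi_plus n \<inter> \<alpha>\<^sub>0 = {}"
    using chart by (simp add: reduction_chart_def Let_def)
  show "\<phi> ` ?H = \<alpha>\<^sub>0"
  proof
    show "\<phi> ` ?H \<subseteq> \<alpha>\<^sub>0"
      using into eq c(2) by auto
    show "\<alpha>\<^sub>0 \<subseteq> \<phi> ` ?H"
    proof
      fix x assume x: "x \<in> \<alpha>\<^sub>0"
      then obtain y where y: "y \<in> unit_ball ?m" "x = ?c y"
        using c(2) by (auto simp: unit_ball_split)
      then obtain b where b: "b \<in> hemi_minus n" "y = h b"
        using homeomorphic_imp_surjective_map[OF h] by auto
      then have "x = \<phi> b"
        using eq y by simp
      then show "x \<in> \<phi> ` ?H"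
        using b disj x by blast
    qed
  qed
qed

lemma chart_hemi_plus_disjoint: "\<phi> ` hemi_plus n \<inter> (\<alpha>\<^sub>0 \<union> \<alpha>\<^sub>1) = {}"
proof -
  have "\<phi> ` hemi_plus n \<inter> \<alpha>\<^sub>0 = {}"
    using chart by (simp add: reduction_chart_def Let_def)
  moreover have "\<phi> ` hemi_plus n \<inter> \<alpha>\<^sub>1 = {}"
    using chart_sphere_lower cell_unique[OF _ facet_pair(2)] by (fastforce simp: sphere_split)
  ultimately show ?thesis by blast
qed

lemma ball_minus_hemi_plus: "unit_ball n - hemi_plus n = open_unit_ball n \<union> (hemi_minus n - hemi_plus n)"
  using open_unit_ball_disjoint_sphere[of n] by (auto simp: unit_ball_split sphere_split)

lemma chart_image_pair: "\<phi> ` (unit_ball n - hemi_plus n) = \<alpha>\<^sub>0 \<union> \<alpha>\<^sub>1"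
  using chart_open_ball chart_open_hemisphere(1) by (simp add: ball_minus_hemi_plus image_Un Un_commute)

text \<open>As \<open>\<phi>(H\<^sub>+)\<close> misses the pair, each point of \<open>\<alpha>\<^sub>0 \<union> \<alpha>\<^sub>1\<close> thus has a unique preimage in the whole ball,
  which is what the collapse map refers to.\<close>

lemma chart_inj_pair: "inj_on \<phi> (unit_ball n - hemi_plus n)"
  unfolding ball_minus_hemi_plus inj_on_Un
proof (intro conjI chart_inj_open_ball chart_open_hemisphere(2))
  have "\<alpha>\<^sub>1 \<inter> \<alpha>\<^sub>0 = {}"
    using cell_unique facet_pair by blast
  moreover have "\<phi> ` (open_unit_ball n - (hemi_minus n - hemi_plus n)) \<subseteq> \<alpha>\<^sub>1"
    using chart_open_ball by blast
  moreover have "\<phi> ` (hemi_minus n - hemi_plus n - open_unit_ball n) \<subseteq> \<alpha>\<^sub>0"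
    using chart_open_hemisphere(1) by blast
  ultimately show "\<phi> ` (open_unit_ball n - (hemi_minus n - hemi_plus n)) \<inter>
      \<phi> ` (hemi_minus n - hemi_plus n - open_unit_ball n) = {}"
    by blast
qed

lemma closure_pair: "X closure_of \<alpha>\<^sub>1 = \<alpha>\<^sub>0 \<union> \<alpha>\<^sub>1 \<union> \<phi> ` hemi_plus n"
  using chart_image_pair hemi_plus_subset unfolding chart_closure by blast

text \<open>\<open>\<phi>(H\<^sub>+)\<close> is a union of remaining cells: it is the subcomplex \<open>\<phi>(S\<^sup>n\<^sup>-\<^sup>1)\<close> without the single cell
  \<open>\<alpha>\<^sub>0\<close>.\<close>

lemma hemi_plus_cells:
  assumes \<tau>: "\<tau> \<in> cells" and x: "x \<in> \<tau>" "x \<in> \<phi> ` hemi_plus n"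
  shows "\<tau> \<subseteq> \<phi> ` hemi_plus n" and "cdim \<tau> < n" and "\<tau> \<in> rest"
proof -
  have "subcomplex K (\<phi> ` bd_sphere n)"
    using chart by (simp add: reduction_chart_def Let_def)
  then obtain C where C: "C \<subseteq> cells" "\<phi> ` bd_sphere n = \<Union>C"
    by (auto simp: subcomplex_def)
  obtain \<rho> where \<rho>: "\<rho> \<in> C" "x \<in> \<rho>"
    using x(2) C(2) by (auto simp: sphere_split)
  then have "\<rho> = \<tau>"
    using C(1) \<tau> x cell_unique by blast
  then have sub: "\<tau> \<subseteq> \<phi> ` bd_sphere n"
    using \<rho> C by blast
  show rest: "\<tau> \<in> rest"
    using \<tau> x chart_hemi_plus_disjoint by blast
  have "\<tau> \<inter> \<alpha>\<^sub>0 = {}"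
    using rest facet_pair cell_unique by blast
  moreover have "\<phi> ` bd_sphere n \<subseteq> \<alpha>\<^sub>0 \<union> \<phi> ` hemi_plus n"
    using chart_open_hemisphere(1) by (auto simp: sphere_split)
  ultimately show "\<tau> \<subseteq> \<phi> ` hemi_plus n"
    using sub by blast
  obtain \<rho> where "\<rho> \<in> cells" "cdim \<rho> < n" "x \<in> \<rho>"
    using x(2) chart_sphere_lower by (auto simp: sphere_split)
  then show "cdim \<tau> < n"
    using x \<tau> cell_unique by blast
qed

subsection \<open>Pushing down the cylinder\<close>

lemma cylinder_image: "\<theta> ` unit_ball n = unit_ball (n - 1) \<times> {0..1}"
  and cylinder_inj: "inj_on \<theta> (unit_ball n)"
  and cylinder_bottom: "\<theta> ` hemi_plus n = unit_ball (n - 1) \<times> {0}"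
proof -
  have "homeomorphic_map (top_of_Rn n (unit_ball n))
      (prod_topology (top_of_Rn (n - 1) (unit_ball (n - 1))) (top_of_set {0..1})) \<theta>"
    using cylinder by (simp add: cylinder_homeo_def)
  from homeomorphic_imp_surjective_map[OF this] homeomorphic_imp_injective_map[OF this]
  show "\<theta> ` unit_ball n = unit_ball (n - 1) \<times> {0..1}" "inj_on \<theta> (unit_ball n)"
    by simp_all
  show "\<theta> ` hemi_plus n = unit_ball (n - 1) \<times> {0}"
    using cylinder by (simp add: cylinder_homeo_def)
qed

lemma push_in_hemi_plus:
  assumes "b \<in> unit_ball n"
  shows "push b \<in> hemi_plus n"
proof -
  have "\<theta> b \<in> unit_ball (n - 1) \<times> {0..1}"
    using cylinder_image assms by blast
  then have "(fst (\<theta> b), 0) \<in> \<theta> ` hemi_plus n"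
    unfolding cylinder_bottom by auto
  then obtain c where "c \<in> hemi_plus n" "\<theta> c = (fst (\<theta> b), 0)"
    by (metis imageE)
  then show ?thesis
    using inv_into_f_f[OF cylinder_inj, of c] hemi_plus_subset by (auto simp: push_def)
qed

lemma push_hemi_plus:
  assumes "b \<in> hemi_plus n"
  shows "push b = b"
proof -
  have "\<theta> b \<in> unit_ball (n - 1) \<times> {0}"
    using cylinder_bottom assms by blast
  then have "(fst (\<theta> b), 0) = \<theta> b"
    by (auto simp: prod_eq_iff)
  then show ?thesis
    using inv_into_f_f[OF cylinder_inj] hemi_plus_subset assms by (auto simp: push_def)
qed

lemma continuous_push: "continuous_map (top_of_Rn n (unit_ball n)) (top_of_Rn n (unit_ball n)) push"
proof -
  let ?B = "top_of_Rn n (unit_ball n)" and ?B' = "top_of_Rn (n - 1) (unit_ball (n - 1))"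
  let ?Z = "prod_topology ?B' (top_of_set {0..1::real})"
  have \<theta>: "homeomorphic_map ?B ?Z \<theta>"
    using cylinder by (simp add: cylinder_homeo_def)
  then obtain g where g: "homeomorphic_maps ?B ?Z \<theta> g"
    by (auto simp: homeomorphic_map_maps)
  have down: "continuous_map ?Z ?Z (\<lambda>z. (fst z, 0))"
    by (auto intro!: continuous_intros continuous_map_pairedI continuous_map_fst)
  have "continuous_map ?B ?B (g \<circ> ((\<lambda>z. (fst z, 0)) \<circ> \<theta>))"
    using g down by (intro continuous_map_compose) (auto simp: homeomorphic_maps_def)
  moreover have "(g \<circ> ((\<lambda>z. (fst z, 0)) \<circ> \<theta>)) b = push b" if "b \<in> topspace ?B" for b
  proof -
    have "\<theta> b \<in> unit_ball (n - 1) \<times> {0..1}"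
      using that unfolding cylinder_image[symmetric] by simp
    then have "(fst (\<theta> b), 0) \<in> topspace ?Z"
      by auto
    then have *: "\<theta> (g (fst (\<theta> b), 0)) = (fst (\<theta> b), 0)" "g (fst (\<theta> b), 0) \<in> unit_ball n"
      using g by (auto simp: homeomorphic_maps_def continuous_map_def Pi_iff)
    show ?thesis
      using inv_into_f_f[OF cylinder_inj *(2)] by (simp add: push_def *(1))
  qed
  ultimately show ?thesis
    by (rule continuous_map_eq)
qed

lemma pushed_off_pair: "x \<notin> \<alpha>\<^sub>0 \<union> \<alpha>\<^sub>1 \<Longrightarrow> pushed x = x"
  by (simp add: collapse_map_def)

text \<open>On the upper hemisphere, both sides are \<open>\<phi> b\<close>: the collapse map is the identity there because
  \<open>\<phi>(H\<^sub>+)\<close> is disjoint from the pair, and \<open>push\<close> because \<open>\<theta>(H\<^sub>+)\<close> is the bottom of the cylinder. Elsewhere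
  \<open>b\<close> is the unique preimage of \<open>\<phi> b\<close>.\<close>

lemma pushed_chart:
  assumes b: "b \<in> unit_ball n"
  shows "pushed (\<phi> b) = \<phi> (push b)"
proof (cases "b \<in> hemi_plus n")
  case True
  then have "\<phi> b \<notin> \<alpha>\<^sub>0 \<union> \<alpha>\<^sub>1"
    using chart_hemi_plus_disjoint by blast
  then show ?thesis
    using push_hemi_plus[OF True] pushed_off_pair by simp
next
  case False
  then have pair: "\<phi> b \<in> \<alpha>\<^sub>0 \<union> \<alpha>\<^sub>1"
    using b chart_image_pair by blast
  have "inv_into (unit_ball n) \<phi> (\<phi> b) = b"
  proof -
    let ?c = "inv_into (unit_ball n) \<phi> (\<phi> b)"
    have c: "?c \<in> unit_ball n" "\<phi> ?c = \<phi> b"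
      using inv_into_into[OF imageI[OF b]] f_inv_into_f[OF imageI[OF b]] by auto
    have "?c \<notin> hemi_plus n"
    proof
      assume "?c \<in> hemi_plus n"
      then have "\<phi> ?c \<in> \<phi> ` hemi_plus n"
        by (rule imageI)
      then have "\<phi> b \<in> \<phi> ` hemi_plus n"
        by (simp only: c(2))
      then show False
        using pair chart_hemi_plus_disjoint by blast
    qed
    then show ?thesis
      using c b False by (intro inj_onD[OF chart_inj_pair]) auto
  qed
  then show ?thesis
    using pair by (simp add: collapse_map_def Let_def push_def)
qed

lemma pushed_closure: "x \<in> X closure_of \<alpha>\<^sub>1 \<Longrightarrow> pushed x \<in> \<phi> ` hemi_plus n"
  unfolding chart_closure using pushed_chart push_in_hemi_plus by auto

lemma pushed_pair: "x \<in> \<alpha>\<^sub>0 \<union> \<alpha>\<^sub>1 \<Longrightarrow> pushed x \<in> \<phi> ` hemi_plus n"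
  using pushed_closure closure_pair by blast

lemma pushed_idem: "pushed (pushed x) = pushed x"
  using pushed_pair pushed_off_pair chart_hemi_plus_disjoint
  by (cases "x \<in> \<alpha>\<^sub>0 \<union> \<alpha>\<^sub>1") (blast, simp)

lemma pushed_topspace: "x \<in> topspace X \<Longrightarrow> pushed x \<in> topspace X"
  using pushed_pair pushed_off_pair[of x] closure_pair closure_of_subset_topspace[of X \<alpha>\<^sub>1]
  by (cases "x \<in> \<alpha>\<^sub>0 \<union> \<alpha>\<^sub>1") auto

subsection \<open>The quotient map\<close>

text \<open>The collapse map fixes the points outside \<open>cl \<alpha>\<^sub>1\<close> and maps \<open>cl \<alpha>\<^sub>1\<close> into itself, so two distinct
  points have the same image only if both lie in \<open>cl \<alpha>\<^sub>1\<close>.\<close>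

lemma collapse_rel_iff:
  "(x, y) \<in> collapse_rel K \<alpha>\<^sub>0 \<alpha>\<^sub>1 \<phi> \<theta> \<longleftrightarrow> x \<in> topspace X \<and> y \<in> topspace X \<and> pushed x = pushed y"
proof -
  have "x \<in> X closure_of \<alpha>\<^sub>1" if "pushed x = pushed y" "x \<noteq> y" for x y
  proof (rule ccontr)
    assume "x \<notin> X closure_of \<alpha>\<^sub>1"
    then have x: "x \<notin> \<alpha>\<^sub>0 \<union> \<alpha>\<^sub>1" "x \<notin> \<phi> ` hemi_plus n"
      unfolding closure_pair by auto
    then have "pushed y = x"
      using that pushed_off_pair by simp
    moreover have "y \<notin> \<alpha>\<^sub>0 \<union> \<alpha>\<^sub>1"
      using x calculation pushed_pair by blast
    ultimately show False
      using that pushed_off_pair by simp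
  qed
  from this[of x y] this[of y x] show ?thesis
    by (auto simp: collapse_rel_def)
qed

lemma \<kappa>_eq_iff:
  "\<lbrakk>x \<in> topspace X; y \<in> topspace X\<rbrakk> \<Longrightarrow> \<kappa> x = \<kappa> y \<longleftrightarrow> pushed x = pushed y"
  by (auto simp: collapse_proj_def collapse_rel_iff set_eq_iff Image_iff)

lemma \<kappa>_pushed: "x \<in> topspace X \<Longrightarrow> \<kappa> (pushed x) = \<kappa> x"
  by (simp add: \<kappa>_eq_iff pushed_topspace pushed_idem)

lemma quotient_map_\<kappa>: "quotient_map X Xq \<kappa>"
  using quotient_map_quotient_topology[of X "collapse_rel K \<alpha>\<^sub>0 \<alpha>\<^sub>1 \<phi> \<theta>"]
  by (simp add: collapse_proj_def[abs_def])

lemmas continuous_\<kappa> = quotient_imp_continuous_map[OF quotient_map_\<kappa>]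
lemmas surjective_\<kappa> = quotient_imp_surjective_map[OF quotient_map_\<kappa>]

text \<open>The saturation of a closed set \<open>C\<close> is \<open>C \<union> \<phi>(E)\<close>, where \<open>E\<close> consists of the points of the ball
  with the same image under \<open>\<phi> \<circ> push\<close> as some point of \<open>\<phi>\<inverse>(C)\<close>. Images under \<open>\<phi>\<close> and \<open>\<phi> \<circ> push\<close> of closed
  subsets of the ball are compact, hence closed, and so \<open>\<phi>(E)\<close> is closed.\<close>

lemma closed_map_\<kappa>: "closed_map X Xq \<kappa>"
  unfolding closed_map_def
proof (intro allI impI)
  fix C assume C: "closedin X C"
  then have CX: "C \<subseteq> topspace X"
    by (rule closedin_subset)
  let ?B = "top_of_Rn n (unit_ball n)"
  define D where "D = {b \<in> topspace ?B. \<phi> b \<in> C}"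
  define E where "E = {b \<in> topspace ?B. (\<phi> \<circ> push) b \<in> (\<phi> \<circ> push) ` D}"
  have D: "closedin ?B D"
    unfolding D_def by (rule closedin_continuous_map_preimage[OF chart_cont C])
  have cont: "continuous_map ?B X (\<phi> \<circ> push)"
    by (rule continuous_map_compose[OF continuous_push chart_cont])
  have E: "closedin ?B E"
    unfolding E_def
    by (rule closedin_continuous_map_preimage[OF cont compactin_char_map_image(2)[OF cont D]])
  have eq: "{x \<in> topspace X. \<kappa> x \<in> \<kappa> ` C} = C \<union> \<phi> ` E"
  proof (intro equalityI subsetI)
    fix x assume "x \<in> {x \<in> topspace X. \<kappa> x \<in> \<kappa> ` C}"
    then obtain y where x: "x \<in> topspace X" and y: "y \<in> C" and "\<kappa> x = \<kappa> y"
      by auto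
    then have "(x, y) \<in> collapse_rel K \<alpha>\<^sub>0 \<alpha>\<^sub>1 \<phi> \<theta>"
      using CX by (simp add: \<kappa>_eq_iff subset_iff collapse_rel_iff)
    then consider "x = y" | "x \<in> X closure_of \<alpha>\<^sub>1" "y \<in> X closure_of \<alpha>\<^sub>1" "pushed x = pushed y"
      by (auto simp: collapse_rel_def)
    then show "x \<in> C \<union> \<phi> ` E"
    proof cases
      case 2
      then obtain b c where bc: "b \<in> unit_ball n" "x = \<phi> b" "c \<in> unit_ball n" "y = \<phi> c"
        unfolding chart_closure by blast
      then have "c \<in> D" and "\<phi> (push b) = \<phi> (push c)"
        using 2 y pushed_chart by (auto simp: D_def)
      then have "b \<in> E"
        using bc by (auto simp: E_def)
      then show ?thesis using bc by blast
    qed (use y in simp)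
  next
    fix x assume "x \<in> C \<union> \<phi> ` E"
    then show "x \<in> {x \<in> topspace X. \<kappa> x \<in> \<kappa> ` C}"
    proof
      assume "x \<in> \<phi> ` E"
      then obtain b c where bc: "b \<in> unit_ball n" "x = \<phi> b" "c \<in> unit_ball n" "\<phi> c \<in> C"
        "\<phi> (push b) = \<phi> (push c)"
        by (auto simp: E_def D_def)
      moreover have "x \<in> topspace X"
        using bc chart_closure closure_of_subset_topspace[of X \<alpha>\<^sub>1] by blast
      ultimately have "\<kappa> x = \<kappa> (\<phi> c)"
        using CX by (subst \<kappa>_eq_iff) (auto simp: pushed_chart)
      then show ?thesis
        using bc \<open>x \<in> topspace X\<close> by blast
    qed (use CX in auto)
  qed
  have "closedin X (C \<union> \<phi> ` E)"
    using C compactin_char_map_image(2)[OF chart_cont E] by (rule closedin_Un)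
  then have "closedin X {x \<in> topspace X. \<kappa> x \<in> \<kappa> ` C}"
    by (simp add: eq)
  moreover have "\<kappa> ` C \<subseteq> topspace Xq"
    using CX surjective_\<kappa> by blast
  ultimately show "closedin Xq (\<kappa> ` C)"
    using quotient_map_\<kappa> by (simp add: quotient_map_closedin)
qed

text \<open>Closed continuous surjections preserve normality and the closedness of points, and a compact
  Hausdorff space is normal.\<close>

lemma Hausdorff_quotient: "Hausdorff_space Xq"
proof (rule normal_t1_imp_Hausdorff_space)
  show "normal_space Xq"
    using compact_Hausdorff_or_regular_imp_normal_space[OF compact_space] Hausdorff
    by (intro normal_space_continuous_closed_map_image[OF _ continuous_\<kappa> closed_map_\<kappa> surjective_\<kappa>]) auto
  show "t1_space Xq"
    unfolding t1_space_closedin_singleton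
  proof
    fix q assume "q \<in> topspace Xq"
    then obtain x where x: "x \<in> topspace X" "q = \<kappa> x"
      unfolding surjective_\<kappa>[symmetric] by blast
    have "closedin X {x}"
      using closedin_Hausdorff_singleton[OF Hausdorff x(1)] .
    then have "closedin Xq (\<kappa> ` {x})"
      using closed_map_\<kappa> unfolding closed_map_def by blast
    then show "closedin Xq {q}"
      by (simp only: x(2) image_insert image_empty)
  qed
qed

lemma closure_\<kappa>: "\<sigma> \<subseteq> topspace X \<Longrightarrow> Xq closure_of (\<kappa> ` \<sigma>) = \<kappa> ` (X closure_of \<sigma>)"
proof
  assume s: "\<sigma> \<subseteq> topspace X"
  show "Xq closure_of (\<kappa> ` \<sigma>) \<subseteq> \<kappa> ` (X closure_of \<sigma>)"
  proof (rule closure_of_minimal)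
    show "closedin Xq (\<kappa> ` (X closure_of \<sigma>))"
      using closed_map_\<kappa> by (simp add: closed_map_def)
  qed (use closure_of_subset[OF s] in blast)
qed (rule continuous_map_image_closure_subset[OF continuous_\<kappa>])

subsection \<open>The cells of the collapse\<close>

lemma rest_off_pair: "\<lbrakk>\<sigma> \<in> rest; x \<in> \<sigma>\<rbrakk> \<Longrightarrow> x \<notin> \<alpha>\<^sub>0 \<union> \<alpha>\<^sub>1"
  using cell_unique facet_pair by blast

lemma \<kappa>_rest_inj:
  assumes "\<sigma> \<in> rest" "x \<in> \<sigma>" "\<tau> \<in> rest" "y \<in> \<tau>" "\<kappa> x = \<kappa> y"
  shows "x = y" and "\<sigma> = \<tau>"
proof -
  have "x \<in> topspace X" "y \<in> topspace X"
    using assms cell_subset by auto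
  then show "x = y"
    using assms \<kappa>_eq_iff pushed_off_pair[OF rest_off_pair] by simp
  then show "\<sigma> = \<tau>"
    using assms cell_unique by blast
qed

lemma inj_on_rest: "inj_on (image \<kappa>) rest"
proof (rule inj_onI)
  fix \<sigma> \<tau> assume *: "\<sigma> \<in> rest" "\<tau> \<in> rest" "\<kappa> ` \<sigma> = \<kappa> ` \<tau>"
  then obtain x where x: "x \<in> \<sigma>"
    using cell_nonempty by blast
  then have "\<kappa> x \<in> \<kappa> ` \<tau>"
    unfolding *(3)[symmetric] by (rule imageI)
  then obtain y where "y \<in> \<tau>" "\<kappa> x = \<kappa> y"
    by (rule imageE)
  then show "\<sigma> = \<tau>"
    using \<kappa>_rest_inj(2)[OF *(1) x *(2)] by simp
qed

lemma collapse_simps: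
  shows "cw_top K' = Xq" and "cw_cells K' = image \<kappa> ` rest"
    and "\<sigma> \<in> rest \<Longrightarrow> cw_dim K' (\<kappa> ` \<sigma>) = cdim \<sigma>"
    and "\<sigma> \<in> rest \<Longrightarrow> cw_char K' (\<kappa> ` \<sigma>) = \<kappa> \<circ> cw_char K \<sigma>"
  using inv_into_f_f[OF inj_on_rest, of \<sigma>] by (simp_all add: collapse_def Let_def)

text \<open>The only way in which the collapse creates incidences. A point \<open>x\<close> of \<open>cl \<sigma>\<close> that is identified
  with a different point \<open>y\<close> of a remaining cell is moved to \<open>y\<close>, so \<open>x\<close> lies in the frontier
  of \<open>\<sigma>\<close> and in one of the cells \<open>\<alpha>\<^sub>0\<close>, \<open>\<alpha>\<^sub>1\<close>, of dimension at least \<open>n - 1\<close>, whereas \<open>y\<close> lies in \<open>\<phi>(H\<^sub>+)\<close>,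
  a union of cells of dimension at most \<open>n - 1\<close>.\<close>

lemma moved_closure_point:
  assumes \<sigma>: "\<sigma> \<in> rest" and x: "x \<in> X closure_of \<sigma>"
    and \<tau>: "\<tau> \<in> rest" and y: "y \<in> \<tau>" and \<kappa>: "\<kappa> x = \<kappa> y" and "x \<noteq> y"
  shows "\<tau> \<subseteq> \<phi> ` hemi_plus n" and "cdim \<tau> < n" and "n \<le> cdim \<sigma>"
    and "cdim \<sigma> = cdim \<tau> + 1 \<Longrightarrow> x \<in> \<alpha>\<^sub>0 \<and> cdim \<sigma> = n"
proof -
  have xX: "x \<in> topspace X"
    using x by (rule subsetD[OF closure_of_subset_topspace])
  have y': "y \<in> topspace X" "pushed y = y"
    using y \<tau> cell_subset pushed_off_pair[OF rest_off_pair] by auto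
  then have "pushed x = y"
    using \<kappa> xX by (simp add: \<kappa>_eq_iff)
  then have pair: "x \<in> \<alpha>\<^sub>0 \<union> \<alpha>\<^sub>1"
    using \<open>x \<noteq> y\<close> pushed_off_pair[of x] by metis
  then have y_plus: "y \<in> \<phi> ` hemi_plus n"
    using pushed_pair \<open>pushed x = y\<close> by metis
  then show \<tau>n: "\<tau> \<subseteq> \<phi> ` hemi_plus n" "cdim \<tau> < n"
    using hemi_plus_cells(1,2)[OF _ y y_plus] \<tau> by simp_all
  from pair show "n \<le> cdim \<sigma>"
  proof
    assume "x \<in> \<alpha>\<^sub>0"
    then show ?thesis
      using frontier_lower_dim[OF _ facet_pair(1) _ x] \<sigma> facet_pair(3) by auto
  next
    assume "x \<in> \<alpha>\<^sub>1"
    then show ?thesis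
      using frontier_lower_dim[OF _ facet_pair(2) _ x] \<sigma> by auto
  qed
  show "x \<in> \<alpha>\<^sub>0 \<and> cdim \<sigma> = n" if dim: "cdim \<sigma> = cdim \<tau> + 1"
  proof -
    have "x \<notin> \<alpha>\<^sub>1"
      using frontier_lower_dim[OF _ facet_pair(2) _ x] \<sigma> \<tau>n dim by auto
    then show ?thesis
      using pair \<tau>n dim \<open>n \<le> cdim \<sigma>\<close> by auto
  qed
qed

lemma \<kappa>_point_in_rest:
  assumes "x \<in> topspace X"
  obtains \<tau> y where "\<tau> \<in> rest" "y \<in> \<tau>" "\<kappa> x = \<kappa> y" "x \<in> \<alpha>\<^sub>0 \<union> \<alpha>\<^sub>1 \<longrightarrow> y \<in> \<phi> ` hemi_plus n"
    "x \<notin> \<alpha>\<^sub>0 \<union> \<alpha>\<^sub>1 \<longrightarrow> y = x"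
proof -
  obtain \<tau> where \<tau>: "\<tau> \<in> cells" "pushed x \<in> \<tau>"
    using cell_exists[OF pushed_topspace[OF assms]] by blast
  have "pushed x \<notin> \<alpha>\<^sub>0 \<union> \<alpha>\<^sub>1"
    using pushed_pair[of x] pushed_off_pair[of x] chart_hemi_plus_disjoint
    by (cases "x \<in> \<alpha>\<^sub>0 \<union> \<alpha>\<^sub>1") auto
  then show thesis
    using \<tau> \<kappa>_pushed[OF assms] pushed_pair pushed_off_pair by (intro that[of \<tau> "pushed x"]) auto
qed

text \<open>The map is closed on \<open>\<sigma>\<close> because \<open>\<kappa>\<close> is closed on \<open>cl \<sigma>\<close> and no point of the frontier of \<open>\<sigma>\<close>
  is moved into \<open>\<sigma>\<close>.\<close>

lemma homeomorphic_\<kappa>_cell: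
  assumes \<sigma>: "\<sigma> \<in> rest"
  shows "homeomorphic_map (subtopology X \<sigma>) (subtopology Xq (\<kappa> ` \<sigma>)) \<kappa>"
proof (rule bijective_closed_imp_homeomorphic_map)
  have sub: "\<sigma> \<subseteq> topspace X" and sub': "\<kappa> ` \<sigma> \<subseteq> topspace Xq"
    using \<sigma> cell_subset surjective_\<kappa> by blast+
  have ts: "topspace (subtopology X \<sigma>) = \<sigma>" "topspace (subtopology Xq (\<kappa> ` \<sigma>)) = \<kappa> ` \<sigma>"
    using sub sub' by auto
  show "continuous_map (subtopology X \<sigma>) (subtopology Xq (\<kappa> ` \<sigma>)) \<kappa>"
    using continuous_\<kappa> by (auto simp: continuous_map_in_subtopology continuous_map_from_subtopology)
  show "\<kappa> ` topspace (subtopology X \<sigma>) = topspace (subtopology Xq (\<kappa> ` \<sigma>))"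
    by (simp only: ts)
  show "inj_on \<kappa> (topspace (subtopology X \<sigma>))"
    unfolding ts using \<kappa>_rest_inj(1)[OF \<sigma> _ \<sigma>] by (auto intro: inj_onI)
  show "closed_map (subtopology X \<sigma>) (subtopology Xq (\<kappa> ` \<sigma>)) \<kappa>"
    unfolding closed_map_def
  proof (intro allI impI)
    fix C assume "closedin (subtopology X \<sigma>) C"
    then obtain T where T: "closedin X T" "C = T \<inter> \<sigma>"
      by (auto simp: closedin_subtopology)
    \<comment> \<open>Cutting down to \<open>cl \<sigma>\<close> removes points of \<open>T\<close> that are moved into \<open>\<sigma>\<close> from elsewhere.\<close>
    define D where "D = T \<inter> X closure_of \<sigma>"
    have "closedin X D"
      unfolding D_def using T(1) by (intro closedin_Int) auto
    then have "closedin Xq (\<kappa> ` D)"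
      using closed_map_\<kappa> by (simp add: closed_map_def)
    moreover have "\<kappa> ` C = \<kappa> ` D \<inter> \<kappa> ` \<sigma>"
    proof
      show "\<kappa> ` C \<subseteq> \<kappa> ` D \<inter> \<kappa> ` \<sigma>"
        using closure_of_subset[OF sub] by (auto simp: D_def T(2))
      show "\<kappa> ` D \<inter> \<kappa> ` \<sigma> \<subseteq> \<kappa> ` C"
      proof
        fix q assume "q \<in> \<kappa> ` D \<inter> \<kappa> ` \<sigma>"
        then obtain x y where xy: "x \<in> D" "y \<in> \<sigma>" "q = \<kappa> x" "\<kappa> x = \<kappa> y"
          by blast
        have "x = y"
        proof (rule ccontr)
          assume "x \<noteq> y"
          have "x \<in> X closure_of \<sigma>"
            using xy by (simp add: D_def)
          from moved_closure_point(2,3)[OF \<sigma> this \<sigma> xy(2,4) \<open>x \<noteq> y\<close>] show False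
            by simp
        qed
        then show "q \<in> \<kappa> ` C"
          using xy by (auto simp: D_def T(2))
      qed
    qed
    ultimately show "closedin (subtopology Xq (\<kappa> ` \<sigma>)) (\<kappa> ` C)"
      unfolding closedin_subtopology by blast
  qed
qed

lemma partition_collapse: "partition_on (topspace Xq) (image \<kappa> ` rest)"
proof (rule partition_onI)
  show "\<Union> (image \<kappa> ` rest) = topspace Xq"
  proof
    show "\<Union> (image \<kappa> ` rest) \<subseteq> topspace Xq"
      using cell_subset surjective_\<kappa> by blast
    show "topspace Xq \<subseteq> \<Union> (image \<kappa> ` rest)"
    proof
      fix q assume "q \<in> topspace Xq"
      then obtain x where x: "x \<in> topspace X" "q = \<kappa> x"
        unfolding surjective_\<kappa>[symmetric] by blast
      then show "q \<in> \<Union> (image \<kappa> ` rest)"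
        by (elim \<kappa>_point_in_rest) auto
    qed
  qed
  show "disjnt p q" if pq: "p \<in> image \<kappa> ` rest" "q \<in> image \<kappa> ` rest" "p \<noteq> q" for p q
  proof -
    obtain \<sigma> \<tau> where st: "\<sigma> \<in> rest" "\<tau> \<in> rest" "p = \<kappa> ` \<sigma>" "q = \<kappa> ` \<tau>"
      using pq(1,2) by blast
    have "False" if "x \<in> \<sigma>" "y \<in> \<tau>" "\<kappa> x = \<kappa> y" for x y
      using \<kappa>_rest_inj(2)[OF st(1) that(1) st(2) that(2,3)] st pq(3) by simp
    then show ?thesis
      unfolding disjnt_def st by blast
  qed
  show "{} \<notin> image \<kappa> ` rest"
    using cell_nonempty by blast
qed

lemma finite_cw_complex_collapse: "finite_cw_complex K'"
  unfolding finite_cw_complex_def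
proof (intro conjI ballI)
  show "Hausdorff_space (cw_top K')"
    by (simp add: collapse_simps Hausdorff_quotient)
  show "finite (cw_cells K')"
    by (simp add: collapse_simps finite_cells)
  show "partition_on (topspace (cw_top K')) (cw_cells K')"
    using partition_collapse by (simp add: collapse_simps)
  fix c assume "c \<in> cw_cells K'"
  then obtain \<sigma> where \<sigma>: "\<sigma> \<in> rest" and c: "c = \<kappa> ` \<sigma>"
    unfolding collapse_simps(2) by blast
  note simps = c collapse_simps(1) collapse_simps(3,4)[OF \<sigma>]
  let ?m = "cdim \<sigma>" and ?\<psi> = "cw_char K \<sigma>"
  have \<sigma>c: "\<sigma> \<in> cells"
    using \<sigma> by simp
  note D = char_map_on_ballD[OF \<sigma>c char_map_on_cw_char]
  show "continuous_map (top_of_Rn (cw_dim K' c) (unit_ball (cw_dim K' c))) (cw_top K') (cw_char K' c)"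
    unfolding simps by (rule continuous_map_compose[OF D(1) continuous_\<kappa>])
  have "homeomorphic_map (top_of_Rn ?m (open_unit_ball ?m)) (subtopology X \<sigma>) ?\<psi>"
    using cw \<sigma>c by (simp add: finite_cw_complex_def)
  then show "homeomorphic_map (top_of_Rn (cw_dim K' c) (open_unit_ball (cw_dim K' c)))
      (subtopology (cw_top K') c) (cw_char K' c)"
    unfolding simps using homeomorphic_\<kappa>_cell[OF \<sigma>] by (rule homeomorphic_map_compose)
  show "cw_char K' c ` bd_sphere (cw_dim K' c) \<subseteq> \<Union> {\<tau> \<in> cw_cells K'. cw_dim K' \<tau> < cw_dim K' c}"
  proof
    fix q assume "q \<in> cw_char K' c ` bd_sphere (cw_dim K' c)"
    then obtain b where b: "b \<in> bd_sphere ?m" "q = \<kappa> (?\<psi> b)"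
      unfolding simps by auto
    then have cl: "?\<psi> b \<in> X closure_of \<sigma>"
      unfolding char_map_on_ball_closure[OF \<sigma>c char_map_on_cw_char] by (simp add: unit_ball_split)
    then have "?\<psi> b \<in> topspace X"
      by (rule subsetD[OF closure_of_subset_topspace])
    then obtain \<tau> y where \<tau>: "\<tau> \<in> rest" and y: "y \<in> \<tau>" "\<kappa> (?\<psi> b) = \<kappa> y"
      by (rule \<kappa>_point_in_rest)
    have "cdim \<tau> < ?m"
    proof (cases "?\<psi> b = y")
      case True
      obtain \<rho> where "\<rho> \<in> cells" "cdim \<rho> < ?m" "?\<psi> b \<in> \<rho>"
        using D(4) b(1) by blast
      then show ?thesis
        using True \<tau> y(1) cell_unique by blast
    next
      case False
      from moved_closure_point(2,3)[OF \<sigma> cl \<tau> y False] show ?thesis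
        by simp
    qed
    moreover have "q \<in> \<kappa> ` \<tau>"
      using b(2) y by simp
    moreover have "\<kappa> ` \<tau> \<in> cw_cells K'"
      unfolding collapse_simps(2) using \<tau> by (rule imageI)
    ultimately show "q \<in> \<Union> {\<tau> \<in> cw_cells K'. cw_dim K' \<tau> < cw_dim K' c}"
      unfolding simps using collapse_simps(3)[OF \<tau>] by (intro UnionI[of "\<kappa> ` \<tau>"]) simp_all
  qed
qed

subsection \<open>Facets and reduction pairs of the collapse\<close>

lemma facet_collapse:
  assumes \<sigma>: "\<sigma> \<in> rest" and \<tau>: "\<tau> \<in> rest" and fac: "facet K \<tau> \<sigma>"
  shows "facet K' (\<kappa> ` \<tau>) (\<kappa> ` \<sigma>)"
proof -
  have "\<sigma> \<subseteq> topspace X"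
    using \<sigma> cell_subset by blast
  then show ?thesis
    using fac \<sigma> \<tau> unfolding facet_def collapse_simps(1,2) collapse_simps(3)[OF \<sigma>] collapse_simps(3)[OF \<tau>]
    by (simp add: closure_\<kappa>) blast
qed

text \<open>A facet of the collapse is old unless it is due to a moved point, which then lies in \<open>\<alpha>\<^sub>0\<close>.\<close>

lemma facet_collapse_cases:
  assumes \<sigma>: "\<sigma> \<in> rest" and \<tau>: "\<tau> \<in> rest" and fac: "facet K' (\<kappa> ` \<tau>) (\<kappa> ` \<sigma>)"
  shows "facet K \<tau> \<sigma> \<or> facet K \<alpha>\<^sub>0 \<sigma> \<and> facet K \<tau> \<alpha>\<^sub>1"
proof -
  have "\<sigma> \<subseteq> topspace X"
    using \<sigma> cell_subset by blast
  then have "\<kappa> ` \<tau> \<inter> \<kappa> ` (X closure_of \<sigma>) \<noteq> {}" and dim: "cdim \<sigma> = cdim \<tau> + 1"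
    using fac unfolding facet_def collapse_simps(1) collapse_simps(3)[OF \<sigma>] collapse_simps(3)[OF \<tau>]
    by (simp_all add: closure_\<kappa>)
  then obtain x y where x: "x \<in> X closure_of \<sigma>" and y: "y \<in> \<tau>" "\<kappa> x = \<kappa> y"
    by blast
  show ?thesis
  proof (cases "x = y")
    case True
    then show ?thesis
      using x y dim \<sigma> \<tau> by (auto simp: facet_def)
  next
    case False
    note M = moved_closure_point[OF \<sigma> x \<tau> y False]
    have "\<tau> \<inter> X closure_of \<alpha>\<^sub>1 \<noteq> {}"
      using M(1) y(1) unfolding closure_pair by blast
    then show ?thesis
      using M(4)[OF dim] x dim \<sigma> \<tau> facet_pair unfolding facet_def by auto
  qed
qed

text \<open>The points of the top of the cylinder are in the open lower hemisphere, and their images already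
  cover the bottom.\<close>

lemma hemi_plus_subset_pushed: "\<phi> ` hemi_plus n \<subseteq> pushed ` \<alpha>\<^sub>0"
proof
  fix p assume "p \<in> \<phi> ` hemi_plus n"
  then obtain b where b: "b \<in> hemi_plus n" "p = \<phi> b"
    by blast
  have "\<theta> b \<in> unit_ball (n - 1) \<times> {0}"
    using cylinder_bottom b(1) by blast
  then obtain u where u: "u \<in> unit_ball (n - 1)" "\<theta> b = (u, 0)"
    by auto
  have "(u, 1) \<in> \<theta> ` hemi_minus n"
    using cylinder u(1) by (simp add: cylinder_homeo_def)
  then obtain c where c: "c \<in> hemi_minus n" "\<theta> c = (u, 1)"
    by (metis imageE)
  have "c \<notin> hemi_plus n"
  proof
    assume "c \<in> hemi_plus n"
    then have "\<theta> c \<in> unit_ball (n - 1) \<times> {0}"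
      unfolding cylinder_bottom[symmetric] by (rule imageI)
    then show False
      using c(2) by simp
  qed
  then have "\<phi> c \<in> \<alpha>\<^sub>0"
    using chart_open_hemisphere(1) c(1) by blast
  moreover have "b \<in> unit_ball n"
    using hemi_plus_subset b(1) by blast
  then have "push c = b"
    using inv_into_f_f[OF cylinder_inj, of b] by (simp add: push_def c(2) u(2))
  then have "pushed (\<phi> c) = p"
    using pushed_chart[of c] c(1) b(2) by (simp add: unit_ball_split sphere_split)
  ultimately show "p \<in> pushed ` \<alpha>\<^sub>0"
    by blast
qed

text \<open>If \<open>L\<close> contains a cell of the pair, then it contains \<open>\<alpha>\<^sub>0\<close>, which lies in \<open>cl \<alpha>\<^sub>1\<close>. The image of \<open>\<alpha>\<^sub>0\<close> is
  that of all of \<open>\<phi>(H\<^sub>+)\<close>, a union of cells, so no cell of the collapse is covered only partly.\<close>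

lemma subcomplex_collapse:
  assumes "subcomplex K L"
  shows "subcomplex K' (\<kappa> ` L)"
proof -
  obtain C where C: "C \<subseteq> cells" "L = \<Union>C" and L: "closedin X L"
    using assms by (auto simp: subcomplex_def)
  have LX: "L \<subseteq> topspace X"
    using L by (rule closedin_subset)
  have meets: "\<sigma> \<subseteq> L" if "\<sigma> \<in> cells" "x \<in> \<sigma>" "x \<in> L" for \<sigma> x
    using that C cell_unique by blast
  have cover: "\<exists>\<tau>\<in>rest. \<kappa> x \<in> \<kappa> ` \<tau> \<and> \<kappa> ` \<tau> \<subseteq> \<kappa> ` L" if x: "x \<in> L" for x
  proof -
    have xX: "x \<in> topspace X"
      using x LX by blast
    obtain \<tau> y where \<tau>: "\<tau> \<in> rest" "y \<in> \<tau>" "\<kappa> x = \<kappa> y"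
      and y: "x \<in> \<alpha>\<^sub>0 \<union> \<alpha>\<^sub>1 \<longrightarrow> y \<in> \<phi> ` hemi_plus n" "x \<notin> \<alpha>\<^sub>0 \<union> \<alpha>\<^sub>1 \<longrightarrow> y = x"
      using xX by (rule \<kappa>_point_in_rest)
    have "\<kappa> ` \<tau> \<subseteq> \<kappa> ` L"
    proof (cases "x \<in> \<alpha>\<^sub>0 \<union> \<alpha>\<^sub>1")
      case True
      have "\<alpha>\<^sub>0 \<subseteq> L"
      proof (cases "x \<in> \<alpha>\<^sub>0")
        case True
        then show ?thesis using meets facet_pair(1) x by blast
      next
        case False
        then have "\<alpha>\<^sub>1 \<subseteq> L"
          using \<open>x \<in> \<alpha>\<^sub>0 \<union> \<alpha>\<^sub>1\<close> meets facet_pair(2) x by blast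
        then have "X closure_of \<alpha>\<^sub>1 \<subseteq> L"
          using L by (rule closure_of_minimal)
        then show ?thesis unfolding closure_pair by blast
      qed
      have "\<tau> \<subseteq> \<phi> ` hemi_plus n"
        using hemi_plus_cells(1)[of \<tau> y] \<tau> y(1) True by blast
      also have "\<dots> \<subseteq> pushed ` \<alpha>\<^sub>0"
        by (rule hemi_plus_subset_pushed)
      finally have "\<kappa> ` \<tau> \<subseteq> \<kappa> ` pushed ` \<alpha>\<^sub>0"
        by blast
      also have "\<dots> = \<kappa> ` \<alpha>\<^sub>0"
        using cell_subset[OF facet_pair(1)] \<kappa>_pushed unfolding image_image by (auto intro!: image_cong)
      also have "\<dots> \<subseteq> \<kappa> ` L"
        using \<open>\<alpha>\<^sub>0 \<subseteq> L\<close> by blast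
      finally show ?thesis .
    next
      case False
      then show ?thesis
        using y(2) \<tau> meets[of \<tau> x] x by blast
    qed
    moreover have "\<kappa> x \<in> \<kappa> ` \<tau>"
      unfolding \<tau>(3) using \<tau>(2) by (rule imageI)
    ultimately show ?thesis using \<tau>(1) by blast
  qed
  \<comment> \<open>The cells of \<open>C\<close> do not suffice: \<open>C\<close> need not contain the cells of \<open>\<phi>(H\<^sub>+)\<close> that receive \<open>\<alpha>\<^sub>0\<close>.\<close>
  define C' where "C' = {c \<in> image \<kappa> ` rest. c \<subseteq> \<kappa> ` L}"
  have "\<kappa> ` L = \<Union>C'"
  proof (rule subset_antisym)
    show "\<kappa> ` L \<subseteq> \<Union>C'"
    proof (rule image_subsetI)
      fix x assume "x \<in> L"
      from cover[OF this] obtain \<tau> where \<tau>: "\<tau> \<in> rest" "\<kappa> x \<in> \<kappa> ` \<tau> \<and> \<kappa> ` \<tau> \<subseteq> \<kappa> ` L"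
        by (rule bexE)
      have "\<kappa> ` \<tau> \<in> C'"
        unfolding C'_def using \<tau> by (intro CollectI conjI imageI) simp_all
      then show "\<kappa> x \<in> \<Union>C'"
        using conjunct1[OF \<tau>(2)] by (rule UnionI)
    qed
    show "\<Union>C' \<subseteq> \<kappa> ` L"
      unfolding C'_def by (rule Union_least) (elim CollectE conjE)
  qed
  moreover have "C' \<subseteq> image \<kappa> ` rest"
    unfolding C'_def by (rule Collect_restrict)
  moreover have "closedin Xq (\<kappa> ` L)"
    using closed_map_\<kappa> L by (simp add: closed_map_def)
  ultimately show ?thesis
    unfolding subcomplex_def collapse_simps(1,2) by (intro conjI exI[of _ C'])
qed

lemma char_map_on_collapse:
  assumes "\<sigma> \<in> rest" "char_map_on K \<sigma> D \<psi>"
  shows "char_map_on K' (\<kappa> ` \<sigma>) D (\<kappa> \<circ> \<psi>)"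
  using assms unfolding char_map_on_def collapse_simps(3,4)[OF assms(1)] by force

text \<open>The excluded configuration is the one in which the collapse drags a point of the upper hemisphere
  of \<open>\<tau>\<close> from \<open>\<alpha>\<^sub>0\<close> into \<open>\<sigma>\<close>.\<close>

lemma reduction_chart_collapse:
  assumes \<sigma>: "\<sigma> \<in> rest" and \<tau>: "\<tau> \<in> rest" and red: "reduction_chart K \<sigma> \<tau> \<psi>"
    and free: "\<not> (facet K \<alpha>\<^sub>0 \<tau> \<and> facet K \<sigma> \<alpha>\<^sub>1)"
  shows "reduction_chart K' (\<kappa> ` \<sigma>) (\<kappa> ` \<tau>) (\<kappa> \<circ> \<psi>)"
proof -
  let ?m = "cdim \<tau>"
  have fac: "facet K \<sigma> \<tau>" and ball: "char_map_on K \<tau> (top_of_Rn ?m (unit_ball ?m)) \<psi>"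
    and sub: "subcomplex K (\<psi> ` bd_sphere ?m)"
    and hemi: "char_map_on K \<sigma> (top_of_Rn ?m (hemi_minus ?m)) \<psi>"
    and disj: "\<psi> ` hemi_plus ?m \<inter> \<sigma> = {}"
    using red by (simp_all add: reduction_chart_def Let_def)
  have dim: "?m = cdim \<sigma> + 1"
    using fac by (simp add: facet_def)
  have "(\<kappa> \<circ> \<psi>) ` hemi_plus ?m \<inter> \<kappa> ` \<sigma> = {}"
  proof (rule ccontr)
    assume "(\<kappa> \<circ> \<psi>) ` hemi_plus ?m \<inter> \<kappa> ` \<sigma> \<noteq> {}"
    then obtain b y where b: "b \<in> hemi_plus ?m" and y: "y \<in> \<sigma>" "\<kappa> (\<psi> b) = \<kappa> y"
      by (force simp: disjoint_iff)
    have "b \<in> unit_ball ?m"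
      using b by (simp add: unit_ball_split sphere_split)
    then have cl: "\<psi> b \<in> X closure_of \<tau>"
      using char_map_on_ball_closure[OF _ ball] \<tau> by blast
    have "\<psi> b \<noteq> y"
      using disj b y(1) by blast
    note M = moved_closure_point[OF \<tau> cl \<sigma> y this]
    have "facet K \<alpha>\<^sub>0 \<tau>"
      using M(4)[OF dim] cl \<tau> facet_pair unfolding facet_def by auto
    moreover have "\<sigma> \<inter> X closure_of \<alpha>\<^sub>1 \<noteq> {}"
      using M(1) y(1) unfolding closure_pair by blast
    then have "facet K \<sigma> \<alpha>\<^sub>1"
      using M(4)[OF dim] dim \<sigma> facet_pair unfolding facet_def by auto
    ultimately show False
      using free by blast
  qed
  moreover have "subcomplex K' ((\<kappa> \<circ> \<psi>) ` bd_sphere ?m)"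
    using subcomplex_collapse[OF sub] by (simp add: image_comp)
  ultimately show ?thesis
    unfolding reduction_chart_def Let_def collapse_simps(3)[OF \<tau>]
    using facet_collapse[OF \<tau> \<sigma> fac] char_map_on_collapse[OF \<tau> ball] char_map_on_collapse[OF \<sigma> hemi]
    by blast
qed

end

section \<open>The induced vector field\<close>

locale vector_field_collapse = cell_collapse K \<alpha>\<^sub>0 \<alpha>\<^sub>1 \<phi> \<theta>
  for K :: "'a cw" and \<alpha>\<^sub>0 \<alpha>\<^sub>1 \<phi> \<theta> +
  fixes V :: "'a set \<rightharpoonup> 'a set"
  assumes vf: "discrete_vector_field K V"
    and acyclic_V: "acyclic_vf K V"
    and V_pair: "V \<alpha>\<^sub>0 = Some \<alpha>\<^sub>1"
begin

definition V\<^sub>\<alpha> :: "'a set set \<rightharpoonup> 'a set set" where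
  "V\<^sub>\<alpha> c = (if c \<in> image \<kappa> ` rest then map_option (image \<kappa>) (V (inv_into rest (image \<kappa>) c)) else None)"

lemma V\<^sub>\<alpha>_cell: "\<sigma> \<in> rest \<Longrightarrow> V\<^sub>\<alpha> (\<kappa> ` \<sigma>) = map_option (image \<kappa>) (V \<sigma>)"
  using inv_into_f_f[OF inj_on_rest, of \<sigma>] by (simp add: V\<^sub>\<alpha>_def)

lemma V_rest:
  assumes "V \<sigma> = Some \<tau>" "\<sigma> \<noteq> \<alpha>\<^sub>0"
  shows "\<sigma> \<in> rest" "\<tau> \<in> rest"
proof -
  have d: "\<sigma> \<in> dom V" "\<alpha>\<^sub>0 \<in> dom V" "\<tau> \<in> ran V" "\<alpha>\<^sub>1 \<in> ran V"
    using assms V_pair by (auto intro: ranI)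
  have V: "dom V \<subseteq> cells" "ran V \<subseteq> cells" "inj_on V (dom V)" "dom V \<inter> ran V = {}"
    using vf by (auto simp: discrete_vector_field_def)
  have "\<tau> \<noteq> \<alpha>\<^sub>1"
    using assms V_pair inj_onD[OF V(3) _ d(1,2)] by auto
  then show "\<sigma> \<in> rest" "\<tau> \<in> rest"
    using d V assms(2) by blast+
qed

lemma V\<^sub>\<alpha>_SomeD:
  assumes "V\<^sub>\<alpha> c = Some d"
  obtains \<sigma> \<tau> where "\<sigma> \<in> rest" "\<tau> \<in> rest" "c = \<kappa> ` \<sigma>" "d = \<kappa> ` \<tau>" "V \<sigma> = Some \<tau>"
proof -
  obtain \<sigma> where \<sigma>: "\<sigma> \<in> rest" "c = \<kappa> ` \<sigma>"
    using assms by (auto simp: V\<^sub>\<alpha>_def split: if_splits)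
  then obtain \<tau> where \<tau>: "V \<sigma> = Some \<tau>" "d = \<kappa> ` \<tau>"
    using assms V\<^sub>\<alpha>_cell by auto
  then show thesis
    using that \<sigma> V_rest(2)[OF \<tau>(1)] by blast
qed

lemma V\<^sub>\<alpha>_dom: "dom V\<^sub>\<alpha> = {\<kappa> ` \<sigma> | \<sigma>. \<sigma> \<in> dom V - {\<alpha>\<^sub>0}}"
proof (intro equalityI subsetI)
  fix c assume "c \<in> dom V\<^sub>\<alpha>"
  then obtain d where "V\<^sub>\<alpha> c = Some d" by blast
  then show "c \<in> {\<kappa> ` \<sigma> | \<sigma>. \<sigma> \<in> dom V - {\<alpha>\<^sub>0}}"
    by (rule V\<^sub>\<alpha>_SomeD) blast
next
  fix c assume "c \<in> {\<kappa> ` \<sigma> | \<sigma>. \<sigma> \<in> dom V - {\<alpha>\<^sub>0}}"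
  then obtain \<sigma> \<tau> where \<sigma>: "c = \<kappa> ` \<sigma>" "V \<sigma> = Some \<tau>" "\<sigma> \<noteq> \<alpha>\<^sub>0" by blast
  then show "c \<in> dom V\<^sub>\<alpha>"
    using V\<^sub>\<alpha>_cell[OF V_rest(1)[OF \<sigma>(2,3)]] by (simp add: domIff)
qed

lemma V_facet: "V \<sigma> = Some \<tau> \<Longrightarrow> facet K \<sigma> \<tau>"
  using vf by (auto simp: discrete_vector_field_def reduction_pair_def reduction_chart_def)

text \<open>The path \<open>\<sigma> \<rightarrow> \<alpha>\<^sub>0 \<rightarrow> \<alpha>\<^sub>1 \<rightarrow> \<tau>\<close>, in which only the middle edge is reversed by \<open>V\<close>.\<close>

lemma path_through_pair:
  assumes \<sigma>: "facet K \<alpha>\<^sub>0 \<sigma>" "\<sigma> \<in> rest" and \<tau>: "facet K \<tau> \<alpha>\<^sub>1" "\<tau> \<in> rest"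
  shows "(\<sigma>, \<tau>) \<in> (vf_graph K V)\<^sup>+"
proof -
  have "V \<tau> \<noteq> Some \<alpha>\<^sub>1"
    using V_rest(2)[of \<tau>] \<tau>(2) by blast
  then have "(\<alpha>\<^sub>1, \<tau>) \<in> vf_graph K V"
    using \<tau>(1) by (simp add: vf_graph_def)
  moreover have "(\<alpha>\<^sub>0, \<alpha>\<^sub>1) \<in> vf_graph K V"
    using V_pair V_facet by (simp add: vf_graph_def)
  moreover have "(\<sigma>, \<alpha>\<^sub>0) \<in> vf_graph K V"
    using \<sigma> V_pair by (auto simp: vf_graph_def)
  ultimately show ?thesis
    by (meson trancl.r_into_trancl trancl.trancl_into_trancl)
qed

text \<open>Otherwise \<open>\<tau> \<rightarrow> \<alpha>\<^sub>0 \<rightarrow> \<alpha>\<^sub>1 \<rightarrow> \<sigma> \<rightarrow> \<tau>\<close> would be a directed cycle.\<close>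

lemma reduction_pair_collapse:
  assumes V: "V \<sigma> = Some \<tau>" and \<sigma>: "\<sigma> \<in> rest" and \<tau>: "\<tau> \<in> rest"
  shows "reduction_pair K' (\<kappa> ` \<sigma>) (\<kappa> ` \<tau>)"
proof -
  obtain \<psi> where \<psi>: "reduction_chart K \<sigma> \<tau> \<psi>"
    using vf V unfolding discrete_vector_field_def reduction_pair_def by blast
  have "\<not> (facet K \<alpha>\<^sub>0 \<tau> \<and> facet K \<sigma> \<alpha>\<^sub>1)"
  proof
    assume "facet K \<alpha>\<^sub>0 \<tau> \<and> facet K \<sigma> \<alpha>\<^sub>1"
    then have "(\<tau>, \<sigma>) \<in> (vf_graph K V)\<^sup>+"
      using path_through_pair \<sigma> \<tau> by blast
    moreover have "(\<sigma>, \<tau>) \<in> vf_graph K V"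
      using V V_facet by (simp add: vf_graph_def)
    ultimately have "(\<tau>, \<tau>) \<in> (vf_graph K V)\<^sup>+"
      by (rule trancl_into_trancl)
    then show False
      using acyclic_V by (simp add: acyclic_vf_def acyclic_def)
  qed
  then show ?thesis
    using reduction_chart_collapse[OF \<sigma> \<tau> \<psi>] unfolding reduction_pair_def by blast
qed

lemma discrete_vector_field_collapse: "discrete_vector_field K' V\<^sub>\<alpha>"
  unfolding discrete_vector_field_def
proof (intro conjI allI impI)
  have V: "inj_on V (dom V)" "dom V \<inter> ran V = {}"
    using vf by (auto simp: discrete_vector_field_def)
  show "finite_cw_complex K'"
    by (rule finite_cw_complex_collapse)
  show "dom V\<^sub>\<alpha> \<subseteq> cw_cells K'" "ran V\<^sub>\<alpha> \<subseteq> cw_cells K'"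
    unfolding collapse_simps(2) ran_def dom_def by (auto elim!: V\<^sub>\<alpha>_SomeD)
  show "inj_on V\<^sub>\<alpha> (dom V\<^sub>\<alpha>)"
  proof (rule inj_onI)
    fix c c' assume "c \<in> dom V\<^sub>\<alpha>" "c' \<in> dom V\<^sub>\<alpha>" and eq: "V\<^sub>\<alpha> c = V\<^sub>\<alpha> c'"
    then obtain d where d: "V\<^sub>\<alpha> c = Some d" "V\<^sub>\<alpha> c' = Some d" by auto
    obtain \<sigma> \<tau> where 1: "\<sigma> \<in> rest" "\<tau> \<in> rest" "c = \<kappa> ` \<sigma>" "d = \<kappa> ` \<tau>" "V \<sigma> = Some \<tau>"
      using d(1) by (rule V\<^sub>\<alpha>_SomeD)
    obtain \<sigma>' \<tau>' where 2: "\<sigma>' \<in> rest" "\<tau>' \<in> rest" "c' = \<kappa> ` \<sigma>'" "d = \<kappa> ` \<tau>'" "V \<sigma>' = Some \<tau>'"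
      using d(2) by (rule V\<^sub>\<alpha>_SomeD)
    have "\<tau> = \<tau>'"
      by (rule inj_onD[OF inj_on_rest trans[OF 1(4)[symmetric] 2(4)] 1(2) 2(2)])
    then have "\<sigma> = \<sigma>'"
      using 1(5) 2(5) by (intro inj_onD[OF V(1)]) auto
    then show "c = c'"
      using 1(3) 2(3) by simp
  qed
  show "dom V\<^sub>\<alpha> \<inter> ran V\<^sub>\<alpha> = {}"
  proof (rule ccontr)
    assume "dom V\<^sub>\<alpha> \<inter> ran V\<^sub>\<alpha> \<noteq> {}"
    then obtain c d e where "V\<^sub>\<alpha> c = Some d" "V\<^sub>\<alpha> d = Some e"
      by (auto simp: ran_def)
    obtain \<sigma> \<tau> where 1: "\<sigma> \<in> rest" "\<tau> \<in> rest" "c = \<kappa> ` \<sigma>" "d = \<kappa> ` \<tau>" "V \<sigma> = Some \<tau>"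
      using \<open>V\<^sub>\<alpha> c = Some d\<close> by (rule V\<^sub>\<alpha>_SomeD)
    obtain \<sigma>' \<tau>' where 2: "\<sigma>' \<in> rest" "\<tau>' \<in> rest" "d = \<kappa> ` \<sigma>'" "e = \<kappa> ` \<tau>'" "V \<sigma>' = Some \<tau>'"
      using \<open>V\<^sub>\<alpha> d = Some e\<close> by (rule V\<^sub>\<alpha>_SomeD)
    have "\<tau> = \<sigma>'"
      by (rule inj_onD[OF inj_on_rest trans[OF 1(4)[symmetric] 2(3)] 1(2) 2(1)])
    then show False
      using 1(5) 2(5) V(2) by (auto simp: ran_def)
  qed
  show "reduction_pair K' c d" if "V\<^sub>\<alpha> c = Some d" for c d
    using that by (rule V\<^sub>\<alpha>_SomeD) (simp add: reduction_pair_collapse)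
qed

text \<open>An edge to an old facet, or against one, is an edge of \<open>K\<close>; an edge to a new facet is replaced by
  the path through the pair.\<close>

lemma collapse_edge_path:
  assumes "(c, d) \<in> vf_graph K' V\<^sub>\<alpha>"
  obtains \<sigma> \<tau> where "\<sigma> \<in> rest" "\<tau> \<in> rest" "c = \<kappa> ` \<sigma>" "d = \<kappa> ` \<tau>" "(\<sigma>, \<tau>) \<in> (vf_graph K V)\<^sup>+"
proof -
  consider "facet K' d c" "V\<^sub>\<alpha> d \<noteq> Some c" | "V\<^sub>\<alpha> c = Some d"
    using assms by (auto simp: vf_graph_def)
  then show thesis
  proof cases
    case 1
    then obtain \<sigma> \<tau> where st: "\<sigma> \<in> rest" "\<tau> \<in> rest" "c = \<kappa> ` \<sigma>" "d = \<kappa> ` \<tau>"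
      unfolding facet_def collapse_simps(2) by blast
    have "V \<tau> \<noteq> Some \<sigma>"
      using 1(2) V\<^sub>\<alpha>_cell[OF st(2)] unfolding st(3,4) by auto
    then have "facet K \<tau> \<sigma> \<Longrightarrow> (\<sigma>, \<tau>) \<in> (vf_graph K V)\<^sup>+"
      by (auto simp: vf_graph_def)
    then show thesis
      using that[OF st] facet_collapse_cases[OF st(1,2) 1(1)[unfolded st(3,4)]]
        path_through_pair[OF _ st(1) _ st(2)] by blast
  next
    case 2
    then obtain \<sigma> \<tau> where st: "\<sigma> \<in> rest" "\<tau> \<in> rest" "c = \<kappa> ` \<sigma>" "d = \<kappa> ` \<tau>" and V: "V \<sigma> = Some \<tau>"
      by (rule V\<^sub>\<alpha>_SomeD)
    have "(\<sigma>, \<tau>) \<in> vf_graph K V"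
      using V V_facet by (simp add: vf_graph_def)
    then show thesis
      using that[OF st] by blast
  qed
qed

lemma acyclic_collapse: "acyclic_vf K' V\<^sub>\<alpha>"
proof -
  let ?cell = "inv_into rest (image \<kappa>)"
  have edge: "(?cell c, ?cell d) \<in> (vf_graph K V)\<^sup>+" if "(c, d) \<in> vf_graph K' V\<^sub>\<alpha>" for c d
    using that by (rule collapse_edge_path) (simp only: inv_into_f_f[OF inj_on_rest])
  have path: "(?cell c, ?cell d) \<in> (vf_graph K V)\<^sup>+" if "(c, d) \<in> (vf_graph K' V\<^sub>\<alpha>)\<^sup>+" for c d
    using that
  proof induction
    case (base d)
    then show ?case by (rule edge)
  next
    case (step d e)
    show ?case by (rule trancl_trans[OF step.IH edge[OF step.hyps(2)]])
  qed
  show ?thesis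
    unfolding acyclic_vf_def acyclic_def
  proof (intro allI notI)
    fix c assume "(c, c) \<in> (vf_graph K' V\<^sub>\<alpha>)\<^sup>+"
    from path[OF this] show False
      using acyclic_V by (simp add: acyclic_vf_def acyclic_def)
  qed
qed

end

theorem theorem3p10:
  fixes K :: "'a cw"
    and V :: "'a set \<rightharpoonup> 'a set"
    and \<alpha>\<^sub>0 \<alpha>\<^sub>1 :: "'a set"
    and \<phi> :: "(nat \<Rightarrow> real) \<Rightarrow> 'a"
    and \<theta> :: "(nat \<Rightarrow> real) \<Rightarrow> (nat \<Rightarrow> real) \<times> real"
  assumes "finite_cw_complex K"
    and "discrete_vector_field K V"
    and "acyclic_vf K V"
    and "V \<alpha>\<^sub>0 = Some \<alpha>\<^sub>1"
    and "reduction_chart K \<alpha>\<^sub>0 \<alpha>\<^sub>1 \<phi>"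
    and "cylinder_homeo (cw_dim K \<alpha>\<^sub>1) \<theta>"
  shows "let \<kappa> = collapse_proj K \<alpha>\<^sub>0 \<alpha>\<^sub>1 \<phi> \<theta>;
             K' = collapse K \<alpha>\<^sub>0 \<alpha>\<^sub>1 \<phi> \<theta>
         in \<exists>V\<^sub>\<alpha>. dom V\<^sub>\<alpha> = {\<kappa> ` \<sigma> | \<sigma>. \<sigma> \<in> dom V - {\<alpha>\<^sub>0}} \<and>
                 (\<forall>\<sigma> \<in> dom V - {\<alpha>\<^sub>0}. V\<^sub>\<alpha> (\<kappa> ` \<sigma>) = Some (\<kappa> ` the (V \<sigma>))) \<and>
                 discrete_vector_field K' V\<^sub>\<alpha> \<and>
                 acyclic_vf K' V\<^sub>\<alpha>"
proof -
  interpret vector_field_collapse K \<alpha>\<^sub>0 \<alpha>\<^sub>1 \<phi> \<theta> V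
    using assms by unfold_locales
  have "V\<^sub>\<alpha> (\<kappa> ` \<sigma>) = Some (\<kappa> ` the (V \<sigma>))" if \<sigma>: "\<sigma> \<in> dom V - {\<alpha>\<^sub>0}" for \<sigma>
  proof -
    obtain \<tau> where V: "V \<sigma> = Some \<tau>" and "\<sigma> \<noteq> \<alpha>\<^sub>0"
      using \<sigma> by blast
    from V\<^sub>\<alpha>_cell[OF V_rest(1)[OF this]] show ?thesis
      by (simp only: V option.map option.sel)
  qed
  then show ?thesis
    unfolding Let_def
    by (intro exI[of _ V\<^sub>\<alpha>] conjI ballI V\<^sub>\<alpha>_dom discrete_vector_field_collapse acyclic_collapse)
qed

end
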